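(* Let $(X;R)$ be a finite symmetrized group presentation containing at least one nonempty relator, let $G=\langle X\mid R\rangle$, let $L(R)=\sum_{r\in R}|r|$, let $H\subset F(X)$ be a nonempty finite set, and let $\mathcal P(\mathcal I)$ and $\mathcal P(H^\pm)$ be any fixed probability distributions on the set $\mathcal I$ of elementary identities and on $H^{\pm}=H\cup H^{-1}$. For $k,n\ge0$ let $\rho_{k,n,H}$ be the distribution of the output of the procedure RandomSubgroupWord on input $((X;R),H,k,n)$. Then the algorithm $\mathcal A_{MP}$ solves the randomized membership search problem $(\mathrm{MSP}(H),\{\rho_{k,n,H}\}_{k,n\ge0})$ generically in time $\tilde O\big((k+n)\,n^{e^2\ln L(R)}\big)$; that is, there is a function $T(k,n)\in\tilde O\big((k+n)n^{e^2\ln L(R)}\big)$ such that for every $k$ $$\rho_{k,n,H}\{\,w'\in \mathrm{MSP}(H) : T_{\mathcal A_{MP}}(w')\le T(k,n)\,\}\to 1\quad\text{as } n\to\infty,$$ where $T_{\mathcal A_{MP}}(w')$ is the running time of $\mathcal A_{MP}$ on input $(X;R)$, $w'$ and the elements of $H$.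
   Context: Notation. $X$ is a finite set, $X^{\pm}=X\cup X^{-1}$, $(X^\pm)^*$ is the free monoid of words, $F(X)$ is the free group (identified with reduced words), $|w|$ is word length, $\circ$ is concatenation, $\overline w$ is the free reduction of $w$. A set $R\subseteq F(X)$ is symmetrized if it consists of cyclically reduced words and is closed under inverses and cyclic permutations; $(X;R)$ is symmetrized if $R$ is. $L(H)=\sum_{h\in H}|h|$. Computations are on a random access machine. $\tilde O(f)$ is the class of functions bounded by $K\max(1,f)\ln^m(2+f)$ for some constants $K,m$; in the claim constants may depend on the presentation, $H$ and the distributions but not on $k$ or $n$. Generator. $\mathcal I=\{xx^{-1},x^{-1}x : x\in X\}\cup R\subset (X^\pm)^*$. A random $\mathcal I$-transformation of a word $v$ inserts a word $u$ sampled from $\mathcal P(\mathcal I)$ into $v$ (without cancellation) at a position $p$ chosen uniformly from $\{0,\dots,|v|\}$, all choices independent. RandomEqualWord$((X;R),v,n)$: set $v^{(0)}=v$; for $i=1,\dots,n$ obtain $v^{(i)}$ from $v^{(i-1)}$ by a random $\mathcal I$-transformation; return $\overline{v^{(n)}}$. RandomSubgroupWord$((X;R),H,k,n)$: let $v=v_1\circ\cdots\circ v_k$ with $v_i$ independently sampled from $\mathcal P(H^\pm)$; let $u$ be the output of RandomEqualWord$((X;R),v,n)$; return $\overline u$. $\mathrm{MSP}(H)=\{w'\in F(X): w'\in\langle H\rangle\text{ in }G\}$. Depth. A generalized van Kampen diagram over $\langle H\rangle\le\langle X\mid R\rangle$ is a finite connected planar digraph $D$ with edges labelled by $X$ (read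 as inverse letters when traversed backwards), with a base vertex $v_0$ on the boundary of the unbounded component $c_{out}$ of $\mathbb R^2\setminus D$, all bounded components (cells, set $C(D)$) being connected and simply connected, such that each cell $c$ either has boundary label in $R$ (up to cyclic permutation and inversion), or has $v_0\in\partial c$ and boundary label read from $v_0$ in $H^\pm$. Its label $\mu(D)$ is read along the boundary of $c_{out}$ counterclockwise from $v_0$. The dual graph has vertex set $C(D)\cup\{c_{out}\}$, with $c_1,c_2$ adjacent iff $\partial c_1\cap\partial c_2\neq\emptyset$; $d^*$ is its graph distance; $\delta(D)=\max_{c\in C(D)}d^*(c,c_{out})$ ($0$ if there are no cells). $\delta_H(w)=\min\{\delta(D):\mu(D)=w\}$ over generalized van Kampen diagrams if $w\in\langle H\rangle$ in $G$, and $\infty$ otherwise. Solver $\mathcal A_{MP}$. On input $(X;R)$, $w$, $h_1,\dots,h_m$: let $\Gamma_0$ be the $X$-digraph consisting of loops labelled $h_1,\dots,h_m$ at a vertex $v_0$ and a path labelled $w$ from $v_0$ to a vertex $v_{end}$. While $v_0\ne v_{end}$ in the current graph $\Gamma_{i-1}$, set $\Gamma_i=S(\mathcal C(\Gamma_{i-1}))$, where $\mathcal C(\Gamma)$ is obtained from $\Gamma$ by adding at every vertex of $\Gamma$ a loop labelled $r$ for every $r\in R$, and $S$ is Stallings folding (performed in nearly linear time). Return YES and the final graph. Its running time on $w$ and $H$ is $\tilde O\big((|w|+L(H))L(R)^{\delta_H(w)}\big)$. *)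

theory Defs
  imports
    "HOL-Probability.Probability_Mass_Function"
    "HOL-Algebra.Coset"
    "HOL-Algebra.Generated_Groups"
begin

section \<open>Words, free groups and presentations\<close>

text \<open>The letter \<open>(x, True)\<close> stands for \<open>x\<close>, and \<open>(x, False)\<close> for its formal inverse.\<close>

type_synonym 'x letter = "'x \<times> bool"
type_synonym 'x word = "'x letter list"

fun inv_letter :: "'x letter \<Rightarrow> 'x letter" where
  "inv_letter (x, b) = (x, \<not> b)"

definition inv_word :: "'x word \<Rightarrow> 'x word" where
  "inv_word w = rev (map inv_letter w)"

definition reduced :: "'x word \<Rightarrow> bool" where
  "reduced w \<longleftrightarrow> successively (\<lambda>a b. b \<noteq> inv_letter a) w"

definition cyclically_reduced :: "'x word \<Rightarrow> bool" where
  "cyclically_reduced w \<longleftrightarrow> reduced w \<and> (w \<noteq> [] \<longrightarrow> hd w \<noteq> inv_letter (last w))"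

fun cons_reduce :: "'x letter \<Rightarrow> 'x word \<Rightarrow> 'x word" where
  "cons_reduce a [] = [a]"
| "cons_reduce a (b # w) = (if b = inv_letter a then w else a # b # w)"

definition free_reduce :: "'x word \<Rightarrow> 'x word" where
  "free_reduce w = foldr cons_reduce w []"

definition free_group :: "'x set \<Rightarrow> 'x word monoid" where
  "free_group X =
    \<lparr>carrier = {w. set w \<subseteq> X \<times> UNIV \<and> reduced w},
     monoid.mult = (\<lambda>u v. free_reduce (u @ v)),
     one = []\<rparr>"

definition symmetrized :: "'x set \<Rightarrow> 'x word set \<Rightarrow> bool" where
  "symmetrized X R \<longleftrightarrow>
    R \<subseteq> carrier (free_group X) \<and>
    (\<forall>r\<in>R. cyclically_reduced r \<and> inv_word r \<in> R \<and> (\<forall>i. rotate i r \<in> R))"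

definition total_length :: "'x word set \<Rightarrow> nat" where
  "total_length A = (\<Sum>w\<in>A. length w)"

definition relator_closure :: "'x set \<Rightarrow> 'x word set \<Rightarrow> 'x word set" where
  "relator_closure X R =
    generate (free_group X)
      {g \<otimes>\<^bsub>free_group X\<^esub> r \<otimes>\<^bsub>free_group X\<^esub> inv\<^bsub>free_group X\<^esub> g | g r.
        g \<in> carrier (free_group X) \<and> r \<in> R}"

definition presented_group :: "'x set \<Rightarrow> 'x word set \<Rightarrow> 'x word set monoid" where
  "presented_group X R = free_group X Mod relator_closure X R"

definition presented_elem :: "'x set \<Rightarrow> 'x word set \<Rightarrow> 'x word \<Rightarrow> 'x word set" where
  "presented_elem X R w = relator_closure X R #>\<^bsub>free_group X\<^esub> w"

definition MSP :: "'x set \<Rightarrow> 'x word set \<Rightarrow> 'x word set \<Rightarrow> 'x word set" where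
  "MSP X R H =
    {w \<in> carrier (free_group X).
      presented_elem X R w \<in> generate (presented_group X R) (presented_elem X R ` H)}"


section \<open>The random generator of subgroup elements\<close>

definition elementary_identities :: "'x set \<Rightarrow> 'x word set \<Rightarrow> 'x word set" where
  "elementary_identities X R =
    {[(x, True), (x, False)] | x. x \<in> X} \<union> {[(x, False), (x, True)] | x. x \<in> X} \<union> R"

definition random_transformation :: "'x word pmf \<Rightarrow> 'x word \<Rightarrow> 'x word pmf" where
  "random_transformation PI v =
    do {u \<leftarrow> PI;
        p \<leftarrow> pmf_of_set {0..length v};
        return_pmf (take p v @ u @ drop p v)}"

primrec random_transformations :: "'x word pmf \<Rightarrow> 'x word \<Rightarrow> nat \<Rightarrow> 'x word pmf" where
  "random_transformations PI v 0 = return_pmf v"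
| "random_transformations PI v (Suc n) =
    do {v' \<leftarrow> random_transformations PI v n; random_transformation PI v'}"

definition random_equal_word :: "'x word pmf \<Rightarrow> 'x word \<Rightarrow> nat \<Rightarrow> 'x word pmf" where
  "random_equal_word PI v n = map_pmf free_reduce (random_transformations PI v n)"

definition random_subgroup_word :: "'x word pmf \<Rightarrow> 'x word pmf \<Rightarrow> nat \<Rightarrow> nat \<Rightarrow> 'x word pmf" where
  "random_subgroup_word PI PH k n =
    do {vs \<leftarrow> replicate_pmf k PH;
        u \<leftarrow> random_equal_word PI (concat vs) n;
        return_pmf (free_reduce u)}"


section \<open>Labelled digraphs and Stallings folding\<close>

text \<open>Vertex names. \<open>Petal h j\<close> and \<open>Stem j\<close> are the vertices at distance \<open>j\<close> from
  \<open>Origin\<close> on the loop labelled \<open>h\<close> and on the input path; \<open>Loop p r j\<close> is an inner vertex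
  of the loop labelled \<open>r\<close> added at \<open>p\<close>. A completion renames each vertex \<open>v\<close> present
  before it to \<open>Old v\<close>, so that the vertices it adds are always fresh.\<close>

datatype 'x vertex =
    Origin
  | Petal "'x word" nat
  | Stem nat
  | Old "'x vertex"
  | Loop "'x vertex" "'x word" nat

record 'x xdigraph =
  verts :: "'x vertex set"
  edges :: "('x vertex \<times> 'x \<times> 'x vertex) set"
  source :: "'x vertex"
  target :: "'x vertex"

definition xdigraphs :: "'x set \<Rightarrow> 'x xdigraph set" where
  "xdigraphs X =
    {\<Gamma>. finite (verts \<Gamma>) \<and> edges \<Gamma> \<subseteq> verts \<Gamma> \<times> X \<times> verts \<Gamma> \<and>
        source \<Gamma> \<in> verts \<Gamma> \<and> target \<Gamma> \<in> verts \<Gamma>}"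

definition graph_size :: "'x xdigraph \<Rightarrow> nat" where
  "graph_size \<Gamma> = card (verts \<Gamma>) + card (edges \<Gamma>)"

definition map_vertices :: "('x vertex \<Rightarrow> 'x vertex) \<Rightarrow> 'x xdigraph \<Rightarrow> 'x xdigraph" where
  "map_vertices f \<Gamma> =
    \<lparr>verts = f ` verts \<Gamma>,
     edges = (\<lambda>(p, x, q). (f p, x, f q)) ` edges \<Gamma>,
     source = f (source \<Gamma>),
     target = f (target \<Gamma>)\<rparr>"

fun letter_edge :: "'x vertex \<Rightarrow> 'x letter \<Rightarrow> 'x vertex \<Rightarrow> 'x vertex \<times> 'x \<times> 'x vertex" where
  "letter_edge p (x, b) q = (if b then (p, x, q) else (q, x, p))"

text \<open>The path labelled \<open>w\<close> that visits \<open>f 0, \<dots>, f (length w)\<close>.\<close>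

definition path_verts :: "(nat \<Rightarrow> 'x vertex) \<Rightarrow> 'x word \<Rightarrow> 'x vertex set" where
  "path_verts f w = f ` {..length w}"

definition path_edges ::
    "(nat \<Rightarrow> 'x vertex) \<Rightarrow> 'x word \<Rightarrow> ('x vertex \<times> 'x \<times> 'x vertex) set" where
  "path_edges f w = (\<lambda>j. letter_edge (f j) (w ! j) (f (Suc j))) ` {..<length w}"

definition stem :: "nat \<Rightarrow> 'x vertex" where
  "stem j = (if j = 0 then Origin else Stem j)"

definition petal :: "'x word \<Rightarrow> nat \<Rightarrow> 'x vertex" where
  "petal h j = (if j = 0 \<or> j = length h then Origin else Petal h j)"

definition loop :: "'x vertex \<Rightarrow> 'x word \<Rightarrow> nat \<Rightarrow> 'x vertex" where
  "loop p r j = (if j = 0 \<or> j = length r then Old p else Loop p r j)"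

definition initial_graph :: "'x word set \<Rightarrow> 'x word \<Rightarrow> 'x xdigraph" where
  "initial_graph H w =
    \<lparr>verts = path_verts stem w \<union> (\<Union>h\<in>H. path_verts (petal h) h),
     edges = path_edges stem w \<union> (\<Union>h\<in>H. path_edges (petal h) h),
     source = Origin,
     target = stem (length w)\<rparr>"

definition completion :: "'x word set \<Rightarrow> 'x xdigraph \<Rightarrow> 'x xdigraph" where
  "completion R \<Gamma> =
    (let \<Gamma>' = map_vertices Old \<Gamma> in
      \<Gamma>'\<lparr>verts := verts \<Gamma>' \<union> (\<Union>p\<in>verts \<Gamma>. \<Union>r\<in>R. path_verts (loop p r) r),
        edges := edges \<Gamma>' \<union> (\<Union>p\<in>verts \<Gamma>. \<Union>r\<in>R. path_edges (loop p r) r)\<rparr>)"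

text \<open>Since edges form a set, the two folded edges merge as soon as their ends do.\<close>

definition fold_step :: "'x xdigraph \<Rightarrow> 'x xdigraph \<Rightarrow> bool" where
  "fold_step \<Gamma> \<Gamma>' \<longleftrightarrow>
    (\<exists>p x q q'. q \<noteq> q' \<and>
      ({(p, x, q), (p, x, q')} \<subseteq> edges \<Gamma> \<or> {(q, x, p), (q', x, p)} \<subseteq> edges \<Gamma>) \<and>
      \<Gamma>' = map_vertices (id(q' := q)) \<Gamma>)"

definition is_stallings_folding :: "'x xdigraph \<Rightarrow> 'x xdigraph \<Rightarrow> bool" where
  "is_stallings_folding \<Gamma> \<Gamma>' \<longleftrightarrow> fold_step\<^sup>*\<^sup>* \<Gamma> \<Gamma>' \<and> (\<nexists>\<Gamma>''. fold_step \<Gamma>' \<Gamma>'')"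


section \<open>The solver and its running time\<close>

definition soft_O :: "'a set \<Rightarrow> ('a \<Rightarrow> real) \<Rightarrow> ('a \<Rightarrow> real) set" where
  "soft_O A f =
    {g. \<exists>(K::real) (m::nat). \<forall>a\<in>A. \<bar>g a\<bar> \<le> K * max 1 (f a) * ln (2 + f a) ^ m}"

text \<open>The part of an implementation on a random access machine that is left open: the
  subroutine used for folding, whose result is determined only up to the names of the vertices,
  and the numbers of machine steps spent on building \<open>\<Gamma>\<^sub>0\<close> for an input word,
  on the test \<open>v\<^sub>0 \<noteq> v\<^sub>e\<^sub>n\<^sub>d\<close>, on computing the completion of a given graph,
  on folding a given graph, and on returning the answer with the final graph.\<close>

record 'x implementation =
  folding :: "'x xdigraph \<Rightarrow> 'x xdigraph"
  time_init :: "'x word \<Rightarrow> nat"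
  time_test :: "'x xdigraph \<Rightarrow> nat"
  time_complete :: "'x xdigraph \<Rightarrow> nat"
  time_fold :: "'x xdigraph \<Rightarrow> nat"
  time_return :: "'x xdigraph \<Rightarrow> nat"

definition implements_solver ::
    "'x set \<Rightarrow> 'x word set \<Rightarrow> 'x word set \<Rightarrow> 'x implementation \<Rightarrow> bool" where
  "implements_solver X R H A \<longleftrightarrow>
    (\<forall>\<Gamma>\<in>xdigraphs X. is_stallings_folding \<Gamma> (folding A \<Gamma>)) \<and>
    (\<lambda>w. real (time_init A w))
      \<in> soft_O (carrier (free_group X)) (\<lambda>w. real (length w + total_length H)) \<and>
    (\<lambda>\<Gamma>. real (time_test A \<Gamma>)) \<in> soft_O (xdigraphs X) (\<lambda>\<Gamma>. real (graph_size \<Gamma>)) \<and>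
    (\<lambda>\<Gamma>. real (time_complete A \<Gamma>))
      \<in> soft_O (xdigraphs X) (\<lambda>\<Gamma>. real (graph_size (completion R \<Gamma>))) \<and>
    (\<lambda>\<Gamma>. real (time_fold A \<Gamma>)) \<in> soft_O (xdigraphs X) (\<lambda>\<Gamma>. real (graph_size \<Gamma>)) \<and>
    (\<lambda>\<Gamma>. real (time_return A \<Gamma>)) \<in> soft_O (xdigraphs X) (\<lambda>\<Gamma>. real (graph_size \<Gamma>))"

primrec solver_graph ::
    "'x implementation \<Rightarrow> 'x word set \<Rightarrow> 'x word set \<Rightarrow> 'x word \<Rightarrow> nat \<Rightarrow> 'x xdigraph" where
  "solver_graph A R H w 0 = initial_graph H w"
| "solver_graph A R H w (Suc i) = folding A (completion R (solver_graph A R H w i))"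

definition exits_at ::
    "'x implementation \<Rightarrow> 'x word set \<Rightarrow> 'x word set \<Rightarrow> 'x word \<Rightarrow> nat \<Rightarrow> bool" where
  "exits_at A R H w i \<longleftrightarrow>
    source (solver_graph A R H w i) = target (solver_graph A R H w i)"

definition running_time ::
    "'x implementation \<Rightarrow> 'x word set \<Rightarrow> 'x word set \<Rightarrow> 'x word \<Rightarrow> ereal" where
  "running_time A R H w =
    (if \<exists>i. exits_at A R H w i then
       (let N = LEAST i. exits_at A R H w i; \<Gamma> = solver_graph A R H w in
          ereal (real (time_init A w +
            (\<Sum>i<N. time_test A (\<Gamma> i) + time_complete A (\<Gamma> i) +
                    time_fold A (completion R (\<Gamma> i))) +
            time_test A (\<Gamma> N) + time_return A (\<Gamma> N))))
     else \<infinity>)"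

end

theory Submission
  imports Defs "HOL-Analysis.Harmonic_Numbers"
begin

text \<open>The insertions that produce the unreduced word \<open>v\<close> form a nested structure. Two facts about its
  depth combine. First, with probability tending to \<open>1\<close> the depth after \<open>n\<close> insertions is below
  \<open>e\<^sup>2 ln n\<close>: weighting a gap of depth \<open>d\<close> by \<open>2\<^sup>d\<close>, the total weight divided by the
  square of the number of gaps is a supermartingale, so Markov's inequality applies. Second, a word
  of nesting depth below \<open>N\<close> makes the solver stop after at most \<open>N\<close> rounds: each round makes
  the insertions of one more level readable as loops, whence \<open>v\<close> labels a closed path at \<open>v\<^sub>0\<close>, while
  its free reduction labels the path from \<open>v\<^sub>0\<close> to \<open>v\<^sub>e\<^sub>n\<^sub>d\<close>; in a folded graph these end at the
  same vertex. A round multiplies the number of vertices by at most \<open>L(R)\<close>, which yields the bound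
  \<open>L(R)\<^bsup>e\<^sup>2 ln n\<^esup> = n\<^bsup>e\<^sup>2 ln L(R)\<^esup>\<close> up to the length of the input and logarithmic factors.\<close>


section \<open>Free reduction and presented groups\<close>

text \<open>Nesting depth takes over the role of the diagram depth. A word has many nestings, while
  the random process lives on words; minimising the weight over all nestings gives a function of the
  word, and the supermartingale inequality survives because an optimal nesting of \<open>v\<close>
  extends to a nesting of every successor of \<open>v\<close>. With base 2 the weight grows on
  average no faster than the square of the length, so any multiple of ln n above 2 / ln 2 (about
  2.89) bounds the depth with high probability. The constant e^2 (about 7.39) leaves room for the
  crude estimates e^2 \<ge> 4 and ln 2 \<ge> 2/3. On the side of the solver, the delicate insertions
  are those of a generator and its inverse: a completion adds loops for relators only, so such an
  insertion need not be readable in the graph. With the threshold e^2 ln n, growth by L(R) + 1 per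
  round would spoil the exponent. Vertices and edges are therefore counted separately: vertices grow
  by the exact factor L(R), and edges cost only one further factor linear in the number of rounds,
  which is logarithmic.\<close>

lemma inv_letter_inv_letter [simp]: "inv_letter (inv_letter a) = a"
  by (cases a) auto

lemma fst_inv_letter [simp]: "fst (inv_letter a) = fst a"
  by (cases a) auto

lemma inv_word_Nil [simp]: "inv_word [] = []"
  by (simp add: inv_word_def)

lemma length_inv_word [simp]: "length (inv_word w) = length w"
  by (simp add: inv_word_def)

lemma inv_word_Cons: "inv_word (a # w) = inv_word w @ [inv_letter a]"
  by (simp add: inv_word_def)

lemma fst_set_inv_word: "fst ` set (inv_word w) = fst ` set w"
  by (simp add: inv_word_def image_image)

lemma letters_subset_iff: "set w \<subseteq> X \<times> UNIV \<longleftrightarrow> fst ` set w \<subseteq> X"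
  by (auto simp: mem_Times_iff)

lemma free_reduce_Nil [simp]: "free_reduce [] = []"
  by (simp add: free_reduce_def)

lemma free_reduce_Cons [simp]: "free_reduce (a # w) = cons_reduce a (free_reduce w)"
  by (simp add: free_reduce_def)

lemma free_reduce_append: "free_reduce (u @ v) = foldr cons_reduce u (free_reduce v)"
  by (simp add: free_reduce_def)

lemma reduced_Nil [simp]: "reduced []"
  by (simp add: reduced_def)

lemma reduced_Cons: "reduced (a # w) \<longleftrightarrow> (w \<noteq> [] \<longrightarrow> hd w \<noteq> inv_letter a) \<and> reduced w"
  by (cases w) (auto simp: reduced_def)

lemma reduced_cons_reduce: "reduced w \<Longrightarrow> reduced (cons_reduce a w)"
  by (cases w) (auto simp: reduced_Cons)

lemma reduced_free_reduce [simp]: "reduced (free_reduce w)"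
  by (induction w) (auto intro: reduced_cons_reduce)

lemma free_reduce_reduced: "reduced w \<Longrightarrow> free_reduce w = w"
proof (induction w)
  case (Cons a w)
  then show ?case by (cases w) (auto simp: reduced_Cons)
qed simp

lemma cons_reduce_cancel:
  "reduced w \<Longrightarrow> cons_reduce a (cons_reduce (inv_letter a) w) = w"
  by (cases w; cases "tl w") (auto simp: reduced_Cons)

text \<open>Letters act on reduced words by mutually inverse permutations (van der Waerden's
  argument), so cancelling a pair does not change the action of a word. Associativity of the free
  group rests on this.\<close>

lemma foldr_cons_reduce_cons_reduce:
  assumes "reduced z"
  shows "foldr cons_reduce (cons_reduce a w) z = cons_reduce a (foldr cons_reduce w z)"
proof (cases w)
  case (Cons b w')
  have "reduced (foldr cons_reduce w' z)"
    using assms by (induction w') (auto intro: reduced_cons_reduce)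
  then show ?thesis
    using Cons by (auto simp: cons_reduce_cancel)
qed simp

lemma free_reduce_append_left [simp]: "free_reduce (free_reduce u @ v) = free_reduce (u @ v)"
  by (induction u) (auto simp: free_reduce_append foldr_cons_reduce_cons_reduce)

lemma free_reduce_append_right [simp]: "free_reduce (u @ free_reduce v) = free_reduce (u @ v)"
  by (simp add: free_reduce_append free_reduce_reduced)

lemma set_cons_reduce: "set (cons_reduce a w) \<subseteq> insert a (set w)"
  by (cases w) auto

lemma set_free_reduce: "set (free_reduce w) \<subseteq> set w"
  by (induction w) (use set_cons_reduce in \<open>fastforce+\<close>)

lemma length_free_reduce: "length (free_reduce w) \<le> length w"
proof (induction w)
  case (Cons a w)
  have "length (cons_reduce a (free_reduce w)) \<le> Suc (length (free_reduce w))"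
    by (cases "free_reduce w") auto
  with Cons show ?case by simp
qed simp

lemma free_reduce_inv_word: "free_reduce (inv_word w @ w) = []"
proof (induction w)
  case (Cons a w)
  have "free_reduce (inv_word (a # w) @ a # w)
      = foldr cons_reduce (inv_word w) (cons_reduce (inv_letter a) (cons_reduce a (free_reduce w)))"
    by (simp add: inv_word_Cons free_reduce_append)
  also have "\<dots> = free_reduce (inv_word w @ w)"
    using cons_reduce_cancel[of "free_reduce w" "inv_letter a"] by (simp add: free_reduce_append)
  finally show ?case using Cons by simp
qed simp

lemma free_reduce_in_carrier:
  "set w \<subseteq> X \<times> UNIV \<Longrightarrow> free_reduce w \<in> carrier (free_group X)"
  using set_free_reduce[of w] by (auto simp: free_group_def)

lemma carrier_free_groupD:
  "w \<in> carrier (free_group X) \<Longrightarrow> set w \<subseteq> X \<times> UNIV"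
  "w \<in> carrier (free_group X) \<Longrightarrow> free_reduce w = w"
  by (simp_all add: free_group_def free_reduce_reduced)

lemma group_free_group: "group (free_group X)"
proof (rule groupI)
  fix x y assume "x \<in> carrier (free_group X)" "y \<in> carrier (free_group X)"
  then show "x \<otimes>\<^bsub>free_group X\<^esub> y \<in> carrier (free_group X)"
    using free_reduce_in_carrier[of "x @ y" X] by (simp add: free_group_def)
next
  fix x assume x: "x \<in> carrier (free_group X)"
  then have "free_reduce (inv_word x) \<in> carrier (free_group X)"
    by (intro free_reduce_in_carrier)
      (auto simp: letters_subset_iff fst_set_inv_word dest!: carrier_free_groupD(1))
  moreover have "free_reduce (inv_word x) \<otimes>\<^bsub>free_group X\<^esub> x = \<one>\<^bsub>free_group X\<^esub>"
    by (simp add: free_group_def free_reduce_inv_word)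
  ultimately show "\<exists>y\<in>carrier (free_group X). y \<otimes>\<^bsub>free_group X\<^esub> x = \<one>\<^bsub>free_group X\<^esub>"
    by blast
qed (auto simp: free_group_def free_reduce_reduced)

lemma free_reduce_mult:
  "free_reduce u \<otimes>\<^bsub>free_group X\<^esub> free_reduce v = free_reduce (u @ v)"
  by (simp add: free_group_def)

section \<open>Evaluating words in the presented group\<close>

lemma normal_relator_closure:
  assumes "R \<subseteq> carrier (free_group X)"
  shows "relator_closure X R \<lhd> free_group X"
  unfolding relator_closure_def
proof (rule group.normal_generateI[OF group_free_group])
  interpret group "free_group X" by (rule group_free_group)
  let ?C = "{g \<otimes>\<^bsub>free_group X\<^esub> r \<otimes>\<^bsub>free_group X\<^esub> inv\<^bsub>free_group X\<^esub> g | g r.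
        g \<in> carrier (free_group X) \<and> r \<in> R}"
  show "?C \<subseteq> carrier (free_group X)"
    using assms by auto
  fix h g assume "h \<in> ?C" and g: "g \<in> carrier (free_group X)"
  then obtain f r where h: "h = f \<otimes>\<^bsub>free_group X\<^esub> r \<otimes>\<^bsub>free_group X\<^esub> inv\<^bsub>free_group X\<^esub> f"
    and f: "f \<in> carrier (free_group X)" and r: "r \<in> R"
    by blast
  have "r \<in> carrier (free_group X)" using r assms by blast
  then have "g \<otimes>\<^bsub>free_group X\<^esub> h \<otimes>\<^bsub>free_group X\<^esub> inv\<^bsub>free_group X\<^esub> g =
      (g \<otimes>\<^bsub>free_group X\<^esub> f) \<otimes>\<^bsub>free_group X\<^esub> r \<otimes>\<^bsub>free_group X\<^esub>
      inv\<^bsub>free_group X\<^esub> (g \<otimes>\<^bsub>free_group X\<^esub> f)"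
    using f g by (simp add: h m_assoc inv_mult_group)
  then show "g \<otimes>\<^bsub>free_group X\<^esub> h \<otimes>\<^bsub>free_group X\<^esub> inv\<^bsub>free_group X\<^esub> g \<in> ?C"
    using f g r by blast
qed

text \<open>Extends \<open>presented_elem\<close> to unreduced words as a homomorphism from the free
  monoid, so that insertions can be evaluated without reducing.\<close>

definition word_value :: "'x set \<Rightarrow> 'x word set \<Rightarrow> 'x word \<Rightarrow> 'x word set" where
  "word_value X R w = presented_elem X R (free_reduce w)"

lemma
  assumes R: "R \<subseteq> carrier (free_group X)"
  shows group_presented_group: "group (presented_group X R)"
    and word_value_in_carrier:
      "set w \<subseteq> X \<times> UNIV \<Longrightarrow> word_value X R w \<in> carrier (presented_group X R)"
    and word_value_append:
      "set u \<subseteq> X \<times> UNIV \<Longrightarrow> set v \<subseteq> X \<times> UNIV \<Longrightarrow>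
        word_value X R (u @ v) = word_value X R u \<otimes>\<^bsub>presented_group X R\<^esub> word_value X R v"
    and word_value_Nil: "word_value X R [] = \<one>\<^bsub>presented_group X R\<^esub>"
    and word_value_relator: "r \<in> R \<Longrightarrow> word_value X R r = \<one>\<^bsub>presented_group X R\<^esub>"
proof -
  interpret normal "relator_closure X R" "free_group X"
    by (rule normal_relator_closure[OF R])
  show gr: "group (presented_group X R)"
    unfolding presented_group_def by (rule factorgroup_is_group)
  show car: "word_value X R w \<in> carrier (presented_group X R)" if "set w \<subseteq> X \<times> UNIV" for w
    using free_reduce_in_carrier[OF that]
    by (auto simp: word_value_def presented_elem_def presented_group_def FactGroup_def RCOSETS_def)
  show app: "word_value X R (u @ v) = word_value X R u \<otimes>\<^bsub>presented_group X R\<^esub> word_value X R v"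
    if "set u \<subseteq> X \<times> UNIV" "set v \<subseteq> X \<times> UNIV" for u v
    using rcos_sum[OF free_reduce_in_carrier[OF that(1)] free_reduce_in_carrier[OF that(2)]]
    by (simp add: word_value_def presented_elem_def presented_group_def FactGroup_def free_reduce_mult)
  have one: "\<one>\<^bsub>presented_group X R\<^esub> = relator_closure X R"
    by (simp add: presented_group_def FactGroup_def)
  have "relator_closure X R #>\<^bsub>free_group X\<^esub> [] = relator_closure X R"
    using coset_mult_one[OF subset] by (simp add: free_group_def)
  then show "word_value X R [] = \<one>\<^bsub>presented_group X R\<^esub>"
    by (simp add: word_value_def presented_elem_def one)
  fix r assume r: "r \<in> R"
  then have rc: "r \<in> carrier (free_group X)" using R by blast
  have "r = \<one>\<^bsub>free_group X\<^esub> \<otimes>\<^bsub>free_group X\<^esub> r \<otimes>\<^bsub>free_group X\<^esub> inv\<^bsub>free_group X\<^esub> \<one>\<^bsub>free_group X\<^esub>"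
    using rc by simp
  then have "r \<in> relator_closure X R"
    unfolding relator_closure_def using r one_closed by (intro generate.incl) blast
  then have "relator_closure X R #>\<^bsub>free_group X\<^esub> r = relator_closure X R"
    using is_group by (rule rcos_const[rotated])
  then show "word_value X R r = \<one>\<^bsub>presented_group X R\<^esub>"
    using carrier_free_groupD(2)[OF rc]
    by (simp add: word_value_def presented_elem_def one)
qed

text \<open>\<open>nested X R H ds v\<close>: the word \<open>v\<close> arises from a product of elements of \<open>H\<^sup>\<plusminus>\<close> by inserting
  elementary identities, and \<open>ds ! i\<close> is the nesting depth of the gap before the \<open>i\<close>-th letter.
  Inserting \<open>u\<close> into a gap of depth \<open>j\<close> leaves depth \<open>j\<close> at both ends of \<open>u\<close>.\<close>

definition gap_depths :: "nat \<Rightarrow> 'x word \<Rightarrow> nat list" where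
  "gap_depths j u = j # replicate (length u - 1) (Suc j) @ [j]"

inductive nested :: "'x set \<Rightarrow> 'x word set \<Rightarrow> 'x word set \<Rightarrow> nat list \<Rightarrow> 'x word \<Rightarrow> bool"
  for X R H where
  product: "set vs \<subseteq> H \<union> inv_word ` H \<Longrightarrow>
    nested X R H (replicate (Suc (length (concat vs))) 0) (concat vs)"
| insertion: "nested X R H (ds1 @ j # ds2) (v1 @ v2) \<Longrightarrow>
    length ds1 = length v1 \<Longrightarrow> length ds2 = length v2 \<Longrightarrow>
    u \<in> elementary_identities X R \<Longrightarrow> u \<noteq> [] \<Longrightarrow>
    nested X R H (ds1 @ gap_depths j u @ ds2) (v1 @ u @ v2)"

lemma elementary_identities_letters:
  assumes "R \<subseteq> carrier (free_group X)" "u \<in> elementary_identities X R"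
  shows "set u \<subseteq> X \<times> UNIV"
  using assms carrier_free_groupD(1)[of u X] by (auto simp: elementary_identities_def)

lemma word_value_elementary_identity:
  assumes "R \<subseteq> carrier (free_group X)" "u \<in> elementary_identities X R"
  shows "word_value X R u = \<one>\<^bsub>presented_group X R\<^esub>"
  using assms word_value_relator[OF assms(1)] word_value_Nil[OF assms(1)]
  by (auto simp: elementary_identities_def word_value_def)

lemma word_value_product:
  assumes R: "R \<subseteq> carrier (free_group X)" and H: "H \<subseteq> carrier (free_group X)"
    and "set vs \<subseteq> H \<union> inv_word ` H"
  shows "set (concat vs) \<subseteq> X \<times> UNIV \<and>
    word_value X R (concat vs) \<in> generate (presented_group X R) (presented_elem X R ` H)"
  using assms(3)
proof (induction vs)
  case Nil
  then show ?case using word_value_Nil[OF R] by (auto intro: generate.one)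
next
  case (Cons g vs)
  interpret P: group "presented_group X R" by (rule group_presented_group[OF R])
  have H': "set h \<subseteq> X \<times> UNIV" "free_reduce h = h" if "h \<in> H" for h
    using that H carrier_free_groupD by blast+
  have g: "set g \<subseteq> X \<times> UNIV \<and>
      word_value X R g \<in> generate (presented_group X R) (presented_elem X R ` H)"
  proof (cases "g \<in> H")
    case True
    then show ?thesis using H' by (auto simp: word_value_def intro: generate.incl)
  next
    case False
    then obtain h where h: "h \<in> H" "g = inv_word h" using Cons.prems by auto
    have gX: "set g \<subseteq> X \<times> UNIV"
      using H'(1)[OF h(1)] by (simp add: h(2) letters_subset_iff fst_set_inv_word)
    have "word_value X R g \<otimes>\<^bsub>presented_group X R\<^esub> word_value X R h = word_value X R (g @ h)"
      using gX H' h by (simp add: word_value_append[OF R])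
    also have "\<dots> = \<one>\<^bsub>presented_group X R\<^esub>"
      using free_reduce_inv_word[of h] word_value_Nil[OF R] by (simp add: h(2) word_value_def)
    finally have "inv\<^bsub>presented_group X R\<^esub> (word_value X R h) = word_value X R g"
      using word_value_in_carrier[OF R] gX H' h by (intro P.inv_equality) auto
    moreover have "word_value X R h \<in> presented_elem X R ` H"
      using h H' by (auto simp: word_value_def)
    ultimately show ?thesis using gX by (metis generate.inv)
  qed
  with Cons show ?case
    by (auto simp: word_value_append[OF R] intro: generate.eng)
qed

lemma nested_imp_MSP:
  assumes R: "R \<subseteq> carrier (free_group X)" and H: "H \<subseteq> carrier (free_group X)"
    and "nested X R H ds v"
  shows "free_reduce v \<in> MSP X R H"
proof -
  interpret P: group "presented_group X R" by (rule group_presented_group[OF R])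
  have "set v \<subseteq> X \<times> UNIV \<and>
    word_value X R v \<in> generate (presented_group X R) (presented_elem X R ` H)"
    using assms(3)
  proof induction
    case (product vs)
    then show ?case by (rule word_value_product[OF R H])
  next
    case (insertion ds1 j ds2 v1 v2 u)
    have u: "set u \<subseteq> X \<times> UNIV" "word_value X R u = \<one>\<^bsub>presented_group X R\<^esub>"
      using insertion.hyps R elementary_identities_letters word_value_elementary_identity by blast+
    then have "word_value X R (v1 @ u @ v2) = word_value X R (v1 @ v2)"
      using insertion.IH word_value_in_carrier[OF R]
      by (simp add: word_value_append[OF R])
    then show ?case using insertion.IH u by auto
  qed
  then show ?thesis
    by (simp add: MSP_def word_value_def free_reduce_in_carrier)
qed


section \<open>Reading words in folded graphs\<close>

text \<open>A walk whose vertices are constrained gap by gap: at a gap of depth \<open>d\<close> it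
  must be in \<open>W d\<close>. This couples the nesting of a word with the layers of a graph. The
  depth list has one entry more than the word.\<close>

primrec tour :: "('x vertex \<times> 'x \<times> 'x vertex) set \<Rightarrow> (nat \<Rightarrow> 'x vertex set) \<Rightarrow>
    'x vertex \<Rightarrow> 'x word \<Rightarrow> nat list \<Rightarrow> 'x vertex \<Rightarrow> bool" where
  "tour E W p [] ds q \<longleftrightarrow> (\<exists>d. ds = [d] \<and> p = q \<and> p \<in> W d)"
| "tour E W p (a # v) ds q \<longleftrightarrow>
    (\<exists>d ds' p'. ds = d # ds' \<and> p \<in> W d \<and> letter_edge p a p' \<in> E \<and> tour E W p' v ds' q)"

text \<open>The gap between the two factors belongs to both, so its depth \<open>d\<close> ends the
  first list and starts the second.\<close>

lemma tour_append:
  assumes "length ds1 = length v1"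
  shows "tour E W p (v1 @ v2) (ds1 @ d # ds2) q \<longleftrightarrow>
    (\<exists>m. tour E W p v1 (ds1 @ [d]) m \<and> tour E W m v2 (d # ds2) q)"
  using assms
proof (induction v1 arbitrary: ds1 p)
  case Nil
  then show ?case by (cases v2) auto
next
  case (Cons a v1)
  then obtain d' ds' where "ds1 = d' # ds'" "length ds' = length v1" by (cases ds1) auto
  with Cons.IH show ?case by auto
qed

lemma tour_append':
  assumes "length ds1 = length v1" "tour E W p v1 (ds1 @ [d]) m" "tour E W m v2 (d # ds2) q"
  shows "tour E W p (v1 @ v2) (ds1 @ d # ds2) q"
  using assms tour_append by blast

lemma tour_mono:
  "tour E W p v ds q \<Longrightarrow> E \<subseteq> E' \<Longrightarrow> (\<And>d. d \<in> set ds \<Longrightarrow> W d \<subseteq> W' d) \<Longrightarrow> tour E' W' p v ds q"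
proof (induction v arbitrary: p ds)
  case (Cons a v)
  then obtain d ds' p' where ds: "ds = d # ds'" and p: "p \<in> W d" "letter_edge p a p' \<in> E"
    and t: "tour E W p' v ds' q"
    by auto
  have "tour E' W' p' v ds' q"
    using t Cons.prems ds by (intro Cons.IH) auto
  moreover have "p \<in> W' d" "letter_edge p a p' \<in> E'"
    using p Cons.prems ds by auto
  ultimately show ?case using ds by auto
qed auto

lemma path_edges_Cons:
  "path_edges f (a # w) = insert (letter_edge (f 0) a (f 1)) (path_edges (\<lambda>i. f (Suc i)) w)"
  by (simp add: path_edges_def lessThan_Suc_eq_insert_0 image_image)

lemma tour_of_path:
  assumes "path_edges f w \<subseteq> E" "length ds = Suc (length w)"
    and "\<And>i. i \<le> length w \<Longrightarrow> f i \<in> W (ds ! i)"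
  shows "tour E W (f 0) w ds (f (length w))"
  using assms
proof (induction w arbitrary: f ds)
  case Nil
  then show ?case by (cases ds) auto
next
  case (Cons a w)
  obtain d ds' where ds: "ds = d # ds'" using Cons.prems by (cases ds) auto
  have "path_edges (\<lambda>i. f (Suc i)) w \<subseteq> E"
    using Cons.prems(1) by (simp add: path_edges_Cons)
  moreover have "f (Suc i) \<in> W (ds' ! i)" if "i \<le> length w" for i
    using Cons.prems(3)[of "Suc i"] that by (simp add: ds)
  ultimately have "tour E W (f (Suc 0)) w ds' (f (Suc (length w)))"
    using Cons.prems(2) ds by (intro Cons.IH[of "\<lambda>i. f (Suc i)"]) auto
  moreover have "letter_edge (f 0) a (f 1) \<in> E"
    using Cons.prems(1) by (simp add: path_edges_Cons)
  ultimately show ?case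
    using Cons.prems(3)[of 0] ds by auto
qed

lemma letter_edge_inv_letter: "letter_edge p (inv_letter a) q = letter_edge q a p"
  by (cases a) auto

lemma tour_inv_word:
  "tour E W p v (replicate (Suc (length v)) d) q \<Longrightarrow>
    tour E W q (inv_word v) (replicate (Suc (length v)) d) p"
proof (induction v arbitrary: p)
  case (Cons a v)
  then obtain p' where p: "p \<in> W d" "letter_edge p a p' \<in> E"
    "tour E W p' v (replicate (Suc (length v)) d) q"
    by auto
  then have "tour E W q (inv_word v) (replicate (length v) d @ [d]) p'"
    using Cons.IH by (simp add: replicate_append_same)
  moreover from p have "p' \<in> W d" by (cases v) auto
  then have "tour E W p' [inv_letter a] [d, d] p"
    using p by (auto simp: letter_edge_inv_letter)
  ultimately have "tour E W q (inv_word v @ [inv_letter a]) (replicate (length v) d @ d # [d]) p"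
    by (intro tour_append') auto
  then show ?case
    by (simp add: inv_word_Cons replicate_append_same replicate_app_Cons_same)
qed simp

text \<open>With \<open>UNIV\<close> as the only layer the constraint is vacuous, and all facts
  about tours apply to plain walks.\<close>

abbreviation walk :: "('x vertex \<times> 'x \<times> 'x vertex) set \<Rightarrow> 'x vertex \<Rightarrow> 'x word \<Rightarrow> 'x vertex \<Rightarrow> bool"
  where "walk E p v q \<equiv> tour E (\<lambda>_. UNIV) p v (replicate (Suc (length v)) 0) q"

lemma walk_Cons: "walk E p (a # v) q \<longleftrightarrow> (\<exists>p'. letter_edge p a p' \<in> E \<and> walk E p' v q)"
  by auto

lemma tour_imp_walk: "tour E W p v ds q \<Longrightarrow> walk E p v q"
  by (induction v arbitrary: p ds) auto

definition folded :: "('x vertex \<times> 'x \<times> 'x vertex) set \<Rightarrow> bool" where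
  "folded E \<longleftrightarrow> (\<forall>p x q q'. ((p, x, q) \<in> E \<and> (p, x, q') \<in> E \<or> (q, x, p) \<in> E \<and> (q', x, p) \<in> E)
    \<longrightarrow> q = q')"

lemma folded_letter_edge:
  "folded E \<Longrightarrow> letter_edge p a q \<in> E \<Longrightarrow> letter_edge p a q' \<in> E \<Longrightarrow> q = q'"
  unfolding folded_def by (cases a) (auto split: if_splits)

lemma walk_deterministic: "folded E \<Longrightarrow> walk E p v q \<Longrightarrow> walk E p v q' \<Longrightarrow> q = q'"
proof (induction v arbitrary: p)
  case (Cons a v)
  then show ?case unfolding walk_Cons by (metis folded_letter_edge)
qed simp

lemma walk_cons_reduce:
  assumes "folded E" "walk E p (a # v) q"
  shows "walk E p (cons_reduce a v) q"
proof (cases v)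
  case (Cons b v')
  show ?thesis
  proof (cases "b = inv_letter a")
    case True
    from assms(2) obtain p1 p2 where "letter_edge p a p1 \<in> E" "letter_edge p1 b p2 \<in> E"
      "walk E p2 v' q"
      unfolding Cons walk_Cons by blast
    then show ?thesis
      using True Cons folded_letter_edge[OF assms(1), of p1 "inv_letter a" p p2]
      by (simp add: letter_edge_inv_letter)
  qed (use assms Cons in simp)
qed (use assms in simp)

lemma walk_free_reduce: "folded E \<Longrightarrow> walk E p v q \<Longrightarrow> walk E p (free_reduce v) q"
proof (induction v arbitrary: p)
  case (Cons a v)
  then have "walk E p (a # free_reduce v) q"
    unfolding walk_Cons by blast
  with Cons.prems(1) show ?case by (simp only: free_reduce_Cons) (rule walk_cons_reduce)
qed simp

section \<open>Vertex maps and Stallings folding\<close>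

definition map_edge :: "('x vertex \<Rightarrow> 'x vertex) \<Rightarrow> 'x vertex \<times> 'x \<times> 'x vertex \<Rightarrow> 'x vertex \<times> 'x \<times> 'x vertex"
  where "map_edge f = (\<lambda>(p, x, q). (f p, x, f q))"

lemma map_vertices_simps [simp]:
  "verts (map_vertices f \<Gamma>) = f ` verts \<Gamma>"
  "edges (map_vertices f \<Gamma>) = map_edge f ` edges \<Gamma>"
  "source (map_vertices f \<Gamma>) = f (source \<Gamma>)"
  "target (map_vertices f \<Gamma>) = f (target \<Gamma>)"
  by (simp_all add: map_vertices_def map_edge_def)

lemma map_edge_letter_edge: "map_edge f (letter_edge p a q) = letter_edge (f p) a (f q)"
  by (cases a) (auto simp: map_edge_def)

lemma map_vertices_comp: "map_vertices f (map_vertices g (\<Gamma> :: 'x xdigraph)) = map_vertices (f \<circ> g) \<Gamma>"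
  by (simp add: map_vertices_def image_image case_prod_unfold)

lemma map_vertices_id: "map_vertices id (\<Gamma> :: 'x xdigraph) = \<Gamma>"
  by (simp add: map_vertices_def)

lemma tour_map:
  "tour E W p v ds q \<Longrightarrow> tour (map_edge f ` E) (\<lambda>d. f ` W d) (f p) v ds (f q)"
proof (induction v arbitrary: p ds)
  case (Cons a v)
  then obtain d ds' p' where ds: "ds = d # ds'" and p: "p \<in> W d" "letter_edge p a p' \<in> E"
    and t: "tour E W p' v ds' q"
    by auto
  have "letter_edge (f p) a (f p') \<in> map_edge f ` E"
    using imageI[OF p(2), of "map_edge f"] by (simp add: map_edge_letter_edge)
  then show ?case using Cons.IH[OF t] p(1) ds by auto
qed auto

text \<open>Each fold identifies two vertices, so a complete folding is the quotient by a single
  vertex map. Walks survive it, and neither the order of the folds nor the names of the vertices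
  matter.\<close>

lemma stallings_folding_map:
  assumes "is_stallings_folding \<Gamma> \<Gamma>'"
  obtains f where "\<Gamma>' = map_vertices f \<Gamma>" "folded (edges \<Gamma>')"
proof -
  have "fold_step\<^sup>*\<^sup>* \<Gamma> \<Gamma>'" using assms by (simp add: is_stallings_folding_def)
  then have map: "\<exists>f. \<Gamma>' = map_vertices f \<Gamma>"
  proof (induction rule: rtranclp_induct)
    case base
    show ?case by (rule exI[of _ id]) (simp only: map_vertices_id)
  next
    case (step y z)
    then obtain f g where "y = map_vertices f \<Gamma>" "z = map_vertices g y"
      by (auto simp: fold_step_def)
    then have "z = map_vertices (g \<circ> f) \<Gamma>" by (simp only: map_vertices_comp)
    then show ?case by (rule exI[of _ "g \<circ> f"])
  qed
  have "folded (edges \<Gamma>')"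
    unfolding folded_def
  proof (intro allI impI)
    fix p x q q'
    assume e: "(p, x, q) \<in> edges \<Gamma>' \<and> (p, x, q') \<in> edges \<Gamma>' \<or>
        (q, x, p) \<in> edges \<Gamma>' \<and> (q', x, p) \<in> edges \<Gamma>'"
    show "q = q'"
    proof (rule ccontr)
      assume "q \<noteq> q'"
      with e have "fold_step \<Gamma>' (map_vertices (id(q' := q)) \<Gamma>')"
        unfolding fold_step_def by (intro exI[of _ p] exI[of _ x] exI[of _ q] exI[of _ q']) simp
      then show False using assms by (simp add: is_stallings_folding_def)
    qed
  qed
  with map show ?thesis by (elim exE) (rule that)
qed

section \<open>The graphs of the solver are finite digraphs over \<open>X\<close>\<close>

lemma path_edges_subset:
  assumes "set w \<subseteq> X \<times> UNIV"
  shows "path_edges f w \<subseteq> path_verts f w \<times> X \<times> path_verts f w"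
proof
  fix e assume "e \<in> path_edges f w"
  then obtain j where j: "j < length w" "e = letter_edge (f j) (w ! j) (f (Suc j))"
    by (auto simp: path_edges_def)
  have "w ! j \<in> X \<times> UNIV" using assms nth_mem[OF j(1)] by auto
  moreover have ends: "f j \<in> path_verts f w" "f (Suc j) \<in> path_verts f w"
    using j(1) by (auto simp: path_verts_def)
  ultimately show "e \<in> path_verts f w \<times> X \<times> path_verts f w"
    using j by (cases "w ! j") (auto split: if_splits)
qed

lemma finite_path_verts [simp]: "finite (path_verts f w)"
  and finite_path_edges [simp]: "finite (path_edges f w)"
  by (simp_all add: path_verts_def path_edges_def)

lemma completion_simps:
  "verts (completion R \<Gamma>) = Old ` verts \<Gamma> \<union> (\<Union>p\<in>verts \<Gamma>. \<Union>r\<in>R. path_verts (loop p r) r)"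
  "edges (completion R \<Gamma>) = map_edge Old ` edges \<Gamma> \<union> (\<Union>p\<in>verts \<Gamma>. \<Union>r\<in>R. path_edges (loop p r) r)"
  "source (completion R \<Gamma>) = Old (source \<Gamma>)"
  "target (completion R \<Gamma>) = Old (target \<Gamma>)"
  by (simp_all add: completion_def Let_def)

lemma map_vertices_xdigraphs:
  assumes "\<Gamma> \<in> xdigraphs X"
  shows "map_vertices f \<Gamma> \<in> xdigraphs X"
proof -
  have "map_edge f ` edges \<Gamma> \<subseteq> f ` verts \<Gamma> \<times> X \<times> f ` verts \<Gamma>"
  proof
    fix e assume "e \<in> map_edge f ` edges \<Gamma>"
    then obtain p x q where "(p, x, q) \<in> edges \<Gamma>" "e = (f p, x, f q)" by (auto simp: map_edge_def)
    then show "e \<in> f ` verts \<Gamma> \<times> X \<times> f ` verts \<Gamma>"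
      using assms unfolding xdigraphs_def by auto
  qed
  then show ?thesis using assms by (simp add: xdigraphs_def)
qed

lemma completion_xdigraphs:
  assumes "\<Gamma> \<in> xdigraphs X" "finite R" "\<forall>r\<in>R. set r \<subseteq> X \<times> UNIV"
  shows "completion R \<Gamma> \<in> xdigraphs X"
proof -
  let ?V = "\<Union>p\<in>verts \<Gamma>. \<Union>r\<in>R. path_verts (loop p r) r"
  have "map_vertices Old \<Gamma> \<in> xdigraphs X" using assms(1) by (rule map_vertices_xdigraphs)
  moreover have "finite ?V"
    using assms by (simp add: xdigraphs_def)
  moreover have "(\<Union>p\<in>verts \<Gamma>. \<Union>r\<in>R. path_edges (loop p r) r) \<subseteq> ?V \<times> X \<times> ?V"
  proof
    fix e assume "e \<in> (\<Union>p\<in>verts \<Gamma>. \<Union>r\<in>R. path_edges (loop p r) r)"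
    then obtain p r where "p \<in> verts \<Gamma>" "r \<in> R" "e \<in> path_edges (loop p r) r" by blast
    then have "e \<in> path_verts (loop p r) r \<times> X \<times> path_verts (loop p r) r"
      using path_edges_subset[of r X "loop p r"] assms(3) by blast
    then show "e \<in> ?V \<times> X \<times> ?V" using \<open>p \<in> verts \<Gamma>\<close> \<open>r \<in> R\<close> by auto
  qed
  moreover have "B \<subseteq> (V \<union> V') \<times> X \<times> (V \<union> V')" if "B \<subseteq> V' \<times> X \<times> V'" for B and V V' :: "'a vertex set"
    using that by fast
  moreover have "A \<subseteq> (V \<union> V') \<times> X \<times> (V \<union> V')" if "A \<subseteq> V \<times> X \<times> V" for A and V V' :: "'a vertex set"
    using that by fast
  ultimately show ?thesis
    by (simp add: xdigraphs_def completion_simps)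
qed

lemma initial_graph_xdigraphs:
  assumes "finite H" "\<forall>h\<in>H. set h \<subseteq> X \<times> UNIV" "set w \<subseteq> X \<times> UNIV"
  shows "initial_graph H w \<in> xdigraphs X"
proof -
  let ?V = "path_verts stem w \<union> (\<Union>h\<in>H. path_verts (petal h) h)"
  have "path_edges stem w \<union> (\<Union>h\<in>H. path_edges (petal h) h) \<subseteq> ?V \<times> X \<times> ?V"
    using path_edges_subset[OF assms(3), of stem] assms(2) path_edges_subset[of _ X] by fast
  moreover have "Origin \<in> path_verts stem w" "stem (length w) \<in> path_verts stem w"
    by (auto simp: path_verts_def stem_def)
  ultimately show ?thesis
    using assms(1) unfolding xdigraphs_def initial_graph_def by simp
qed


section \<open>Rounds of the solver and nesting depth\<close>

definition relator_letters :: "'x word set \<Rightarrow> 'x set" where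
  "relator_letters R = (\<Union>r\<in>R. fst ` set r)"

text \<open>\<open>W j\<close> plays the role of the image of the \<open>j\<close>-th graph of the solver in the \<open>N\<close>-th one.\<close>

definition layered :: "'x word set \<Rightarrow> 'x word set \<Rightarrow> 'x word \<Rightarrow> nat \<Rightarrow> 'x xdigraph \<Rightarrow>
    (nat \<Rightarrow> 'x vertex set) \<Rightarrow> bool" where
  "layered R H w N \<Gamma> W \<longleftrightarrow>
    W N = verts \<Gamma> \<and> mono W \<and> finite (W 0) \<and> source \<Gamma> \<in> W 0 \<and>
    (\<forall>h\<in>H. tour (edges \<Gamma>) W (source \<Gamma>) h (replicate (Suc (length h)) 0) (source \<Gamma>)) \<and>
    (\<forall>j<N. \<forall>p\<in>W j. \<forall>r\<in>R. r \<noteq> [] \<longrightarrow> tour (edges \<Gamma>) W p r (gap_depths j r) p) \<and>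
    (\<forall>(p, x, q)\<in>edges \<Gamma>. x \<notin> relator_letters R \<longrightarrow> p \<in> W 0 \<and> q \<in> W 0) \<and>
    walk (edges \<Gamma>) (source \<Gamma>) w (target \<Gamma>)"

text \<open>Before the first round no relator loop is demanded, so every layer may be the whole
  vertex set.\<close>

lemma layered_initial_graph:
  assumes "initial_graph H w \<in> xdigraphs X"
  shows "layered R H w 0 (initial_graph H w) (\<lambda>_. verts (initial_graph H w))"
proof -
  let ?\<Gamma> = "initial_graph H w"
  have "tour (edges ?\<Gamma>) (\<lambda>_. verts ?\<Gamma>) (petal h 0) h (replicate (Suc (length h)) 0) (petal h (length h))"
    if "h \<in> H" for h
    using that by (intro tour_of_path) (auto simp: initial_graph_def path_verts_def simp del: replicate_Suc)
  moreover have "walk (edges ?\<Gamma>) (stem 0) w (stem (length w))"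
    by (intro tour_of_path) (auto simp: initial_graph_def simp del: replicate_Suc)
  ultimately show ?thesis
    using assms unfolding layered_def xdigraphs_def
    by (auto simp: mono_def initial_graph_def petal_def stem_def simp del: replicate_Suc)
qed

lemma nth_gap_depths:
  assumes "i \<le> length r" "r \<noteq> []"
  shows "gap_depths j r ! i = (if i = 0 \<or> i = length r then j else Suc j)"
  using assms by (cases i) (auto simp: gap_depths_def nth_append nth_Cons')

lemma length_gap_depths: "r \<noteq> [] \<Longrightarrow> length (gap_depths j r) = Suc (length r)"
  by (simp add: gap_depths_def)

text \<open>Old layers are carried along by renaming followed by folding, and the new top layer is
  the whole vertex set. Hence only the loops at layer \<open>N\<close> are new, and these are what
  the completion supplies.\<close>

lemma layered_completion:
  assumes l: "layered R H w N \<Gamma> W" and \<Gamma>': "\<Gamma>' = map_vertices f (completion R \<Gamma>)"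
    and fin: "completion R \<Gamma> \<in> xdigraphs X"
  shows "\<exists>W'. layered R H w (Suc N) \<Gamma>' W'"
proof -
  define e where "e = f \<circ> Old"
  define W' where "W' j = (if j \<le> N then e ` W j else verts \<Gamma>')" for j
  note L = l[unfolded layered_def]
  have WN: "W N = verts \<Gamma>" and "mono W" using L by auto
  have edges: "map_edge e ` edges \<Gamma> \<subseteq> edges \<Gamma>'"
    by (auto simp: \<Gamma>' completion_simps image_image map_edge_def e_def comp_def case_prod_unfold image_Un)
  have verts: "e ` verts \<Gamma> \<subseteq> verts \<Gamma>'"
    by (auto simp: \<Gamma>' completion_simps e_def)
  have src: "source \<Gamma>' = e (source \<Gamma>)" and tgt: "target \<Gamma>' = e (target \<Gamma>)"
    by (simp_all add: \<Gamma>' completion_simps e_def)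
  have "mono W'"
  proof (rule monoI)
    fix i j :: nat assume "i \<le> j"
    moreover have "W i \<subseteq> W j" "i \<le> N \<Longrightarrow> W i \<subseteq> verts \<Gamma>"
      using \<open>mono W\<close> \<open>i \<le> j\<close> WN by (auto simp: mono_def)
    ultimately show "W' i \<subseteq> W' j" using verts by (auto simp: W'_def)
  qed
  have tour': "tour (edges \<Gamma>') W' (e p) v ds (e q)"
    if "tour (edges \<Gamma>) W p v ds q" "\<And>d. d \<in> set ds \<Longrightarrow> d \<le> N" for p v ds q
    using tour_map[OF that(1), of e] by (rule tour_mono) (use edges that(2) in \<open>auto simp: W'_def\<close>)
  have petals: "tour (edges \<Gamma>') W' (source \<Gamma>') h (replicate (Suc (length h)) 0) (source \<Gamma>')"
    if "h \<in> H" for h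
    unfolding src using L that by (intro tour') (auto simp del: replicate_Suc)
  have loops: "tour (edges \<Gamma>') W' p r (gap_depths j r) p"
    if j: "j < Suc N" and p: "p \<in> W' j" and r: "r \<in> R" "r \<noteq> []" for j p r
  proof -
    from p j obtain p' where p': "p = e p'" "p' \<in> W j" by (auto simp: W'_def)
    show ?thesis
    proof (cases "j < N")
      case True
      then have "tour (edges \<Gamma>) W p' r (gap_depths j r) p'"
        using L p' r by blast
      then show ?thesis
        unfolding p' by (rule tour') (use True in \<open>auto simp: gap_depths_def\<close>)
    next
      case False
      with j have "j = N" by simp
      with p' WN have p'v: "p' \<in> verts \<Gamma>" by simp
      \<comment> \<open>A provisional layering before folding. Only the depths \<open>N\<close> and
        \<open>Suc N\<close> occur on the loop: the base vertex at the ends, arbitrary vertices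
        inside. Its image under \<open>f\<close> lies in \<open>W'\<close>.\<close>
      define W'' where "W'' i = (if i = N then {Old p'} else verts (completion R \<Gamma>))" for i
      have "tour (edges (completion R \<Gamma>)) W'' (loop p' r 0) r (gap_depths N r) (loop p' r (length r))"
      proof (rule tour_of_path)
        show "path_edges (loop p' r) r \<subseteq> edges (completion R \<Gamma>)"
          using p'v r by (auto simp: completion_simps)
        show "loop p' r i \<in> W'' (gap_depths N r ! i)" if "i \<le> length r" for i
        proof (cases "i = 0 \<or> i = length r")
          case True
          then show ?thesis using that r by (auto simp: nth_gap_depths W''_def loop_def)
        next
          case False
          have "loop p' r i \<in> verts (completion R \<Gamma>)"
            using p'v r that by (auto simp: completion_simps path_verts_def)
          then show ?thesis using False that r by (simp add: nth_gap_depths W''_def)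
        qed
      qed (use r in \<open>simp add: length_gap_depths\<close>)
      then have "tour (edges (completion R \<Gamma>)) W'' (Old p') r (gap_depths N r) (Old p')"
        by (simp add: loop_def)
      from tour_map[OF this, of f]
      have "tour (edges \<Gamma>') (\<lambda>i. f ` W'' i) p r (gap_depths N r) p"
        by (simp add: \<Gamma>' p' e_def)
      then show ?thesis
        unfolding \<open>j = N\<close>
      proof (rule tour_mono)
        fix d assume "d \<in> set (gap_depths N r)"
        then have "d = N \<or> d = Suc N" by (auto simp: gap_depths_def)
        then show "f ` W'' d \<subseteq> W' d"
          using p' p \<open>j = N\<close> by (auto simp: W''_def W'_def \<Gamma>' e_def)
      qed simp
    qed
  qed
  have old: "p \<in> W' 0 \<and> q \<in> W' 0" if e: "(p, x, q) \<in> edges \<Gamma>'" and x: "x \<notin> relator_letters R" for p x q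
  proof -
    \<comment> \<open>The label of an added edge occurs in a relator, so an edge with any other
      label is the image of an edge of \<open>\<Gamma>\<close>.\<close>
    have notin: "(p, x, q) \<notin> path_edges g r" if "r \<in> R" for p q g r
    proof
      assume "(p, x, q) \<in> path_edges g r"
      then obtain i where i: "i < length r" "(p, x, q) = letter_edge (g i) (r ! i) (g (Suc i))"
        by (auto simp: path_edges_def)
      then have "fst (r ! i) = x" by (cases "r ! i") (auto split: if_splits)
      then show False
        using i x \<open>r \<in> R\<close> nth_mem[of i r] unfolding relator_letters_def by blast
    qed
    from e obtain p1 q1 where pq: "(p1, x, q1) \<in> edges (completion R \<Gamma>)" "p = f p1" "q = f q1"
      by (auto simp: \<Gamma>' map_edge_def)
    with notin obtain p2 q2 where "(p2, x, q2) \<in> edges \<Gamma>" "p1 = Old p2" "q1 = Old q2"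
      by (auto simp: completion_simps map_edge_def)
    then have "p = e p2" "q = e q2" "p2 \<in> W 0" "q2 \<in> W 0"
      using pq L x by (auto simp: e_def)
    then show ?thesis by (auto simp: W'_def)
  qed
  have "walk (edges \<Gamma>') (source \<Gamma>') w (target \<Gamma>')"
    unfolding src tgt
    by (rule tour_mono[OF tour_map[where f = e]]) (use L edges in auto)
  moreover have "W' (Suc N) = verts \<Gamma>'" by (simp add: W'_def)
  moreover have "finite (W' 0)" "source \<Gamma>' \<in> W' 0" using L src by (auto simp: W'_def)
  moreover have "\<forall>(p, x, q)\<in>edges \<Gamma>'. x \<notin> relator_letters R \<longrightarrow> p \<in> W' 0 \<and> q \<in> W' 0"
    using old by auto
  moreover have "\<forall>h\<in>H. tour (edges \<Gamma>') W' (source \<Gamma>') h (replicate (Suc (length h)) 0) (source \<Gamma>')"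
    using petals by blast
  moreover have "\<forall>j<Suc N. \<forall>p\<in>W' j. \<forall>r\<in>R. r \<noteq> [] \<longrightarrow> tour (edges \<Gamma>') W' p r (gap_depths j r) p"
    using loops by blast
  ultimately show ?thesis
    unfolding layered_def using \<open>mono W'\<close> by (intro exI[of _ W'] conjI)
qed

text \<open>Domain and range have the same size, so in the finite set \<open>A\<close> their
  complements do too and can be matched by an arbitrary bijection.\<close>

lemma partial_injection_extends:
  assumes "finite A" and r: "r \<subseteq> A \<times> A" and "single_valued r" and "single_valued (r\<inverse>)"
  obtains s where "bij_betw s A A" "\<And>p q. (p, q) \<in> r \<Longrightarrow> s p = q"
proof -
  define f where "f p = (THE q. (p, q) \<in> r)" for p
  have f: "f p = q" if "(p, q) \<in> r" for p q
    unfolding f_def using that \<open>single_valued r\<close> by (intro the_equality) (auto simp: single_valued_def)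
  have bij_f: "bij_betw f (Domain r) (Range r)"
    unfolding bij_betw_def
  proof
    show "inj_on f (Domain r)"
      using f \<open>single_valued (r\<inverse>)\<close> unfolding inj_on_def single_valued_def by auto
    show "f ` Domain r = Range r" using f by force
  qed
  have sub: "Domain r \<subseteq> A" "Range r \<subseteq> A" using r by auto
  then have "finite (Domain r)" "finite (Range r)"
    using \<open>finite A\<close> by (auto intro: finite_subset)
  then have "card (A - Domain r) = card (A - Range r)"
    using sub bij_betw_same_card[OF bij_f] by (simp add: card_Diff_subset)
  then obtain g where "bij_betw g (A - Domain r) (A - Range r)"
    using finite_same_card_bij[of "A - Domain r" "A - Range r"] \<open>finite A\<close> by auto
  then have "bij_betw (\<lambda>p. if p \<in> Domain r then f p else g p) (Domain r \<union> (A - Domain r))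
      (Range r \<union> (A - Range r))"
    by (intro bij_betw_disjoint_Un bij_f) auto
  moreover have "Domain r \<union> (A - Domain r) = A" "Range r \<union> (A - Range r) = A"
    using sub by auto
  ultimately have "bij_betw (\<lambda>p. if p \<in> Domain r then f p else g p) A A"
    by simp
  then show ?thesis
    by (rule that) (use f in auto)
qed

text \<open>Closure under inversion and rotation moves any occurrence of the generator to the front
  with the required sign. A relator loop at a vertex then provides an edge on which this letter can
  be read there.\<close>

lemma symmetrized_relator_starting:
  assumes "symmetrized X R" "fst a \<in> relator_letters R"
  obtains r where "a # r \<in> R"
proof -
  obtain s where "s \<in> R" "a \<in> set s \<or> inv_letter a \<in> set s"
  proof -
    obtain s b where "s \<in> R" "b \<in> set s" "fst b = fst a"
      using assms(2) by (auto simp: relator_letters_def)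
    moreover have "b = a \<or> b = inv_letter a"
      using \<open>fst b = fst a\<close> by (cases a; cases b) auto
    ultimately show ?thesis using that by blast
  qed
  moreover have "inv_word s \<in> R" "a \<in> set (inv_word s)" if "s \<in> R" "inv_letter a \<in> set s" for s
    using that assms(1) image_eqI[of a inv_letter "inv_letter a" "set s"]
    by (auto simp: symmetrized_def inv_word_def)
  ultimately obtain s where s: "s \<in> R" "a \<in> set s" by blast
  then obtain i where i: "i < length s" "s ! i = a" by (auto simp: in_set_conv_nth)
  have "rotate i s = a # drop (Suc i) s @ take i s"
    using i by (simp add: rotate_drop_take Cons_nth_drop_Suc[symmetric])
  moreover have "rotate i s \<in> R" using assms(1) s by (auto simp: symmetrized_def)
  ultimately show ?thesis using that by metis
qed

text \<open>A letter that occurs in no relator labels edges of the bottom layer only. These edges form a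
  partial injection of a finite set, so they can be completed to a permutation of the bottom layer;
  in the graph extended in this way every insertion is read as a loop, even one of \<open>x x\<^sup>-\<^sup>1\<close> at a
  vertex without an edge labelled \<open>x\<close>.\<close>

lemma layered_source_eq_target:
  assumes l: "layered R H w N \<Gamma> W" and fold: "folded (edges \<Gamma>)" and sym: "symmetrized X R"
    and nst: "nested X R H ds v" and depth: "\<forall>d\<in>set ds. d < N"
    and w: "w = free_reduce (free_reduce v)"
  shows "source \<Gamma> = target \<Gamma>"
proof -
  note L = l[unfolded layered_def]
  have "mono W" using L by blast
  define E where "E x = {(p, q). (p, x, q) \<in> edges \<Gamma>}" for x
  have ex: "\<exists>s. x \<notin> relator_letters R \<longrightarrow>
      bij_betw s (W 0) (W 0) \<and> (\<forall>p q. (p, x, q) \<in> edges \<Gamma> \<longrightarrow> s p = q)" for x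
  proof (cases "x \<in> relator_letters R")
    case False
    obtain s where "bij_betw s (W 0) (W 0)" "\<And>p q. (p, q) \<in> E x \<Longrightarrow> s p = q"
    proof (rule partial_injection_extends[of "W 0" "E x"])
      show "single_valued (E x)" "single_valued ((E x)\<inverse>)"
        using fold by (auto simp: E_def single_valued_def folded_def)
      show "E x \<subseteq> W 0 \<times> W 0"
        using L False by (auto simp: E_def)
    qed (use L in auto)
    then show ?thesis by (auto simp: E_def)
  qed auto
  obtain s where s: "\<And>x. x \<notin> relator_letters R \<Longrightarrow> bij_betw (s x) (W 0) (W 0)"
      "\<And>x p q. x \<notin> relator_letters R \<Longrightarrow> (p, x, q) \<in> edges \<Gamma> \<Longrightarrow> s x p = q"
    using choice[of "\<lambda>x s. x \<notin> relator_letters R \<longrightarrow>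
      bij_betw s (W 0) (W 0) \<and> (\<forall>p q. (p, x, q) \<in> edges \<Gamma> \<longrightarrow> s p = q)"] ex by blast
  \<comment> \<open>The identity outside the bottom layer keeps \<open>s' x\<close> injective and
    makes it total, so the extended graph stays folded and every such letter, or its inverse, can be
    read at every vertex without climbing to a higher layer.\<close>
  define s' where "s' x p = (if p \<in> W 0 then s x p else p)" for x p
  define E' where "E' = {(p, x, q). if x \<in> relator_letters R then (p, x, q) \<in> edges \<Gamma> else q = s' x p}"
  have sub: "edges \<Gamma> \<subseteq> E'"
    using s(2) L by (auto simp: E'_def s'_def)
  have inj: "inj (s' x)" if "x \<notin> relator_letters R" for x
  proof (rule injI)
    fix p q assume "s' x p = s' x q"
    then show "p = q"
      using s(1)[OF that] unfolding s'_def bij_betw_def inj_on_def by (metis imageI)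
  qed
  have fold': "folded E'"
    using fold inj unfolding folded_def E'_def inj_def by (auto split: if_splits)
  have step: "\<exists>q\<in>W (Suc j). letter_edge p a q \<in> E'" if j: "j < N" and p: "p \<in> W j" for j p a
  proof (cases "fst a \<in> relator_letters R")
    case True
    then obtain r where r: "a # r \<in> R" using symmetrized_relator_starting[OF sym] by blast
    then have "tour (edges \<Gamma>) W p (a # r) (gap_depths j (a # r)) p"
      using L j p by blast
    then obtain q where q: "letter_edge p a q \<in> edges \<Gamma>"
      and t: "tour (edges \<Gamma>) W q r (replicate (length r) (Suc j) @ [j]) p"
      by (auto simp: gap_depths_def)
    \<comment> \<open>For a relator of length one, \<open>q\<close> is the base vertex and has depth
      \<open>j\<close>; otherwise it is an inner vertex of depth \<open>Suc j\<close>.\<close>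
    have "q \<in> W j \<union> W (Suc j)" using t by (cases r) auto
    then have "q \<in> W (Suc j)" using \<open>mono W\<close> monoD[of W j "Suc j"] by auto
    then show ?thesis using q sub by blast
  next
    case False
    obtain x b where a: "a = (x, b)" by (cases a)
    have bij: "bij_betw (s x) (W 0) (W 0)" using False s(1) a by simp
    have "W 0 \<subseteq> W (Suc j)" "W j \<subseteq> W (Suc j)" using \<open>mono W\<close> by (auto simp: mono_def)
    moreover have "\<exists>q\<in>W 0 \<union> W j. letter_edge p a q \<in> E'"
    proof (cases "p \<in> W 0")
      case True
      \<comment> \<open>Surjectivity serves the inverse letter, which is read against the direction
        of the permutation.\<close>
      have "p \<in> s x ` W 0" using True bij by (simp add: bij_betw_def)
      then obtain q where "q \<in> W 0" "p = s x q" by (rule imageE)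
      moreover have "s x p \<in> W 0" using True bij by (auto simp: bij_betw_def)
      ultimately show ?thesis using True False a by (cases b) (auto simp: E'_def s'_def)
    next
      case notin: False
      then show ?thesis using p False a by (auto simp: E'_def s'_def)
    qed
    ultimately show ?thesis by blast
  qed
  have ident: "tour E' W p u (gap_depths j u) p"
    if u: "u \<in> elementary_identities X R" "u \<noteq> []" and j: "j < N" and p: "p \<in> W j" for u j p
  proof (cases "u \<in> R")
    case True
    then have "tour (edges \<Gamma>) W p u (gap_depths j u) p" using L j p u by blast
    then show ?thesis by (rule tour_mono[OF _ sub]) simp
  next
    case False
    then obtain x b where "u = [(x, b), inv_letter (x, b)]"
      using u by (auto simp: elementary_identities_def)
    moreover obtain q where "q \<in> W (Suc j)" "letter_edge p (x, b) q \<in> E'"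
      using step[OF j p] by blast
    ultimately show ?thesis
      using p by (auto simp: gap_depths_def letter_edge_inv_letter simp del: inv_letter.simps)
  qed
  have base: "tour E' W (source \<Gamma>) (concat vs) (replicate (Suc (length (concat vs))) 0) (source \<Gamma>)"
    if "set vs \<subseteq> H \<union> inv_word ` H" for vs
    using that
  proof (induction vs)
    case Nil
    then show ?case using L by simp
  next
    case (Cons g vs)
    have "tour (edges \<Gamma>) W (source \<Gamma>) g (replicate (Suc (length g)) 0) (source \<Gamma>)"
    proof (cases "g \<in> H")
      case False
      then obtain h where "h \<in> H" "g = inv_word h" using Cons.prems by auto
      then show ?thesis using tour_inv_word[of "edges \<Gamma>" W "source \<Gamma>" h 0] L by (auto simp del: replicate_Suc)
    qed (use L in blast)
    then have "tour E' W (source \<Gamma>) g (replicate (length g) 0 @ [0]) (source \<Gamma>)"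
      by (intro tour_mono[OF _ sub]) (auto simp: replicate_append_same)
    then have "tour E' W (source \<Gamma>) (g @ concat vs)
        (replicate (length g) 0 @ 0 # replicate (length (concat vs)) 0) (source \<Gamma>)"
      using Cons by (intro tour_append'[where m = "source \<Gamma>"]) auto
    then show ?case
      by (simp add: replicate_add replicate_app_Cons_same)
  qed
  have "tour E' W (source \<Gamma>) v ds (source \<Gamma>)"
    using nst depth
  proof induction
    case (product vs)
    then show ?case using base by blast
  next
    case (insertion ds1 j ds2 v1 v2 u)
    \<comment> \<open>Both ends of the inserted word keep the depth of the gap, so the bound on the
      resulting depths still covers \<open>j\<close>, and the induction hypothesis applies.\<close>
    have j: "j < N" using insertion.prems by (auto simp: gap_depths_def)
    have "tour E' W (source \<Gamma>) (v1 @ v2) (ds1 @ j # ds2) (source \<Gamma>)"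
      using insertion.prems by (intro insertion.IH) (auto simp: gap_depths_def)
    then obtain m where m: "tour E' W (source \<Gamma>) v1 (ds1 @ [j]) m" "tour E' W m v2 (j # ds2) (source \<Gamma>)"
      using tour_append insertion.hyps by blast
    have "m \<in> W j" using m(2) by (cases v2) auto
    then have "tour E' W m u (gap_depths j u) m"
      using ident insertion.hyps j by blast
    then have "tour E' W m (u @ v2) (gap_depths j u @ ds2) (source \<Gamma>)"
      using m(2) insertion.hyps tour_append'[of "j # replicate (length u - 1) (Suc j)" u E' W m j m v2 ds2]
      by (cases u) (auto simp: gap_depths_def simp del: tour.simps)
    then show ?case
      using tour_append'[OF insertion.hyps(2) m(1), of "u @ v2"] by (simp add: gap_depths_def)
  qed
  \<comment> \<open>The closed walk may use added edges, but \<open>E'\<close> is folded as well and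
    both end vertices are those of \<open>\<Gamma>\<close>, so determinism in \<open>E'\<close>
    gives the equality in \<open>\<Gamma>\<close>.\<close>
  then have "walk E' (source \<Gamma>) w (source \<Gamma>)"
    unfolding w by (intro walk_free_reduce fold' tour_imp_walk)
  moreover have "walk E' (source \<Gamma>) w (target \<Gamma>)"
    by (rule tour_mono[OF _ sub]) (use L in auto)
  ultimately show ?thesis
    using walk_deterministic[OF fold'] by blast
qed


section \<open>The nesting depth of a random word\<close>

lemma nested_length: "nested X R H ds v \<Longrightarrow> length ds = Suc (length v)"
  by (induction rule: nested.induct) (auto simp: gap_depths_def Suc_diff_le simp flip: length_greater_0_conv)

definition depth_weight :: "nat list \<Rightarrow> real" where
  "depth_weight ds = (\<Sum>d\<leftarrow>ds. 2 ^ d)"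

text \<open>The least weight of a nesting of \<open>v\<close>, divided by the square of the number of gaps, is a
  supermartingale: an insertion of \<open>l\<close> letters into one of \<open>N\<close> gaps multiplies the expected weight
  by at most \<open>1 + (2l - 1) / N \<le> ((N + l) / N)\<^sup>2\<close>.\<close>

definition nesting_weight :: "'x set \<Rightarrow> 'x word set \<Rightarrow> 'x word set \<Rightarrow> 'x word \<Rightarrow> real" where
  "nesting_weight X R H v = Inf (depth_weight ` {ds. nested X R H ds v})"

definition nesting_potential :: "'x set \<Rightarrow> 'x word set \<Rightarrow> 'x word set \<Rightarrow> 'x word \<Rightarrow> real" where
  "nesting_potential X R H v = nesting_weight X R H v / (real (length v) + 1)\<^sup>2"

lemma depth_weight_nonneg: "0 \<le> depth_weight ds"
  by (induction ds) (auto simp: depth_weight_def)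

lemma nesting_weight_le: "nested X R H ds v \<Longrightarrow> nesting_weight X R H v \<le> depth_weight ds"
  unfolding nesting_weight_def
  by (rule cInf_lower) (auto intro!: bdd_belowI[of _ 0] depth_weight_nonneg)

lemma nesting_weight_nonneg: "nested X R H ds v \<Longrightarrow> 0 \<le> nesting_weight X R H v"
  unfolding nesting_weight_def by (rule cInf_greatest) (auto simp: depth_weight_nonneg)

text \<open>Weights are natural numbers, so the infimum is a minimum and one optimal nesting can be
  fixed before averaging over positions.\<close>

lemma nesting_weight_attained:
  assumes "nested X R H ds v"
  obtains ds' where "nested X R H ds' v" "nesting_weight X R H v = depth_weight ds'"
proof -
  define w where "w ds = (\<Sum>d\<leftarrow>ds. 2 ^ d :: nat)" for ds
  have w: "depth_weight ds = real (w ds)" for ds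
    by (induction ds) (auto simp: depth_weight_def w_def)
  obtain ds' where ds': "nested X R H ds' v" "\<And>ds. nested X R H ds v \<Longrightarrow> w ds' \<le> w ds"
    using assms ex_has_least_nat[of "\<lambda>ds. nested X R H ds v" ds w] by blast
  then have "nesting_weight X R H v = depth_weight ds'"
    unfolding nesting_weight_def by (intro cInf_eq_minimum) (auto simp: w)
  with ds' that show ?thesis by blast
qed

text \<open>With l the length of \<open>u\<close>, one gap of weight 2^d becomes two gaps of weight
  2^d and l - 1 of weight 2^(d+1), a gain of 2^d (2l - 1).\<close>

lemma depth_weight_insertion:
  assumes "p < length ds" "u \<noteq> []"
  shows "depth_weight (take p ds @ gap_depths (ds ! p) u @ drop (Suc p) ds)
    = depth_weight ds + 2 ^ (ds ! p) * (2 * real (length u) - 1)"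
proof -
  have "depth_weight ds = depth_weight (take p ds @ ds ! p # drop (Suc p) ds)"
    using assms(1) by (simp add: id_take_nth_drop[symmetric])
  moreover have "1 \<le> length u" using assms(2) by (cases u) auto
  ultimately show ?thesis
    by (simp add: depth_weight_def gap_depths_def sum_list_replicate of_nat_diff algebra_simps)
qed

lemma nested_insert:
  assumes "nested X R H ds v" "u \<in> elementary_identities X R" "u \<noteq> []" "p \<le> length v"
  shows "nested X R H (take p ds @ gap_depths (ds ! p) u @ drop (Suc p) ds) (take p v @ u @ drop p v)"
proof (rule nested.insertion)
  have len: "length ds = Suc (length v)" using assms(1) by (rule nested_length)
  then have "take p ds @ ds ! p # drop (Suc p) ds = ds"
    using assms(4) by (simp add: id_take_nth_drop[symmetric])
  then show "nested X R H (take p ds @ ds ! p # drop (Suc p) ds) (take p v @ drop p v)"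
    using assms(1) by simp
  show "length (take p ds) = length (take p v)" "length (drop (Suc p) ds) = length (drop p v)"
    using len assms(4) by auto
qed (use assms in auto)

lemma sum_nesting_potential_insertions_le:
  assumes "nested X R H ds v" "u \<in> elementary_identities X R"
  shows "(\<Sum>p\<in>{0..length v}. nesting_potential X R H (take p v @ u @ drop p v))
    \<le> (real (length v) + 1) * nesting_potential X R H v"
\<comment> \<open>The empty word may be a relator. Inserting it changes neither word nor potential,
  so that case is settled by the final simplification.\<close>
proof (cases "u = []")
  case False
  obtain ds where ds: "nested X R H ds v" and w: "nesting_weight X R H v = depth_weight ds"
    using assms(1) by (rule nesting_weight_attained)
  define N l S where "N = real (length v) + 1" and "l = real (length u)" and "S = depth_weight ds"
  have len: "length ds = Suc (length v)" using ds by (rule nested_length)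
  have l: "1 \<le> l" using False by (cases u) (auto simp: l_def)
  have N: "1 \<le> N" by (simp add: N_def)
  have "(\<Sum>p\<in>{0..length v}. 2 ^ (ds ! p)) = S"
    using len by (simp add: S_def depth_weight_def sum_list_sum_nth atLeast0AtMost
        atLeast0LessThan lessThan_Suc_atMost)
  moreover have "(\<Sum>p\<in>{0..length v}. nesting_weight X R H (take p v @ u @ drop p v))
      \<le> (\<Sum>p\<in>{0..length v}. S + 2 ^ (ds ! p) * (2 * l - 1))"
  proof (rule sum_mono)
    fix p assume p: "p \<in> {0..length v}"
    then have "nested X R H (take p ds @ gap_depths (ds ! p) u @ drop (Suc p) ds) (take p v @ u @ drop p v)"
      using ds assms(2) False by (intro nested_insert) auto
    from nesting_weight_le[OF this]
    show "nesting_weight X R H (take p v @ u @ drop p v) \<le> S + 2 ^ (ds ! p) * (2 * l - 1)"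
      using p len False by (simp add: depth_weight_insertion S_def l_def)
  qed
  ultimately have "(\<Sum>p\<in>{0..length v}. nesting_weight X R H (take p v @ u @ drop p v))
      \<le> S * (N + 2 * l - 1)"
    by (simp add: sum.distrib flip: sum_distrib_right) (simp add: N_def algebra_simps)
  moreover have "length (take p v @ u @ drop p v) = length v + length u" for p
    by simp
  ultimately have "(\<Sum>p\<in>{0..length v}. nesting_potential X R H (take p v @ u @ drop p v))
      \<le> S * (N + 2 * l - 1) / (N + l)\<^sup>2"
    unfolding nesting_potential_def
    by (simp add: N_def l_def divide_right_mono add_ac flip: sum_divide_distrib)
  also have "\<dots> \<le> S / N"
  proof -
    \<comment> \<open>The right side exceeds the left by l^2 + N.\<close>
    have "(N + 2 * l - 1) * N \<le> (N + l)\<^sup>2" using l N by (simp add: power2_eq_square algebra_simps)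
    then have "(N + 2 * l - 1) / (N + l)\<^sup>2 \<le> 1 / N" using l N by (simp add: field_simps)
    then show ?thesis
      using mult_left_mono[of "(N + 2 * l - 1) / (N + l)\<^sup>2" "1 / N" S] depth_weight_nonneg[of ds]
      by (simp add: S_def)
  qed
  also have "S / N = N * nesting_potential X R H v"
    using N by (simp add: nesting_potential_def w S_def N_def power2_eq_square)
  finally show ?thesis by (simp add: N_def)
qed (simp add: add.commute)

text \<open>The estimate holds for each inserted identity separately, so it passes to an average
  over any distribution of identities; only the position has to be uniform.\<close>

lemma nn_integral_random_transformation_le:
  assumes "nested X R H ds v" and PI: "set_pmf PI \<subseteq> elementary_identities X R"
  shows "(\<integral>\<^sup>+ v'. ennreal (nesting_potential X R H v') \<partial>random_transformation PI v)
    \<le> ennreal (nesting_potential X R H v)"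
proof -
  let ?P = "nesting_potential X R H"
  have inner: "(\<integral>\<^sup>+ p. ennreal (?P (take p v @ u @ drop p v)) \<partial>pmf_of_set {0..length v}) \<le> ennreal (?P v)"
    if u: "u \<in> elementary_identities X R" for u
  proof -
    \<comment> \<open>Without a nesting the potential would be built from an infimum over the empty
      set; its sign is known only from an explicit nesting of the new word.\<close>
    have nonneg: "0 \<le> ?P (take p v @ u @ drop p v)" if "p \<le> length v" for p
    proof (cases "u = []")
      case True
      then show ?thesis
        using nesting_weight_nonneg[OF assms(1)] by (simp add: nesting_potential_def)
    next
      case False
      then show ?thesis
        using nesting_weight_nonneg nested_insert[OF assms(1) u False that]
        unfolding nesting_potential_def by (intro divide_nonneg_nonneg) auto
    qed
    have "(\<integral>\<^sup>+ p. ennreal (?P (take p v @ u @ drop p v)) \<partial>pmf_of_set {0..length v})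
        = (\<Sum>p\<in>{0..length v}. ennreal (?P (take p v @ u @ drop p v))) / of_nat (card {0..length v})"
      by (rule nn_integral_pmf_of_set) auto
    also have "\<dots> = ennreal ((\<Sum>p\<in>{0..length v}. ?P (take p v @ u @ drop p v)) / (real (length v) + 1))"
    proof -
      have "of_nat (card {0..length v}) = ennreal (real (length v) + 1)"
        by (simp add: ennreal_of_nat_eq_real_of_nat add.commute)
      moreover have "0 \<le> (\<Sum>p\<in>{0..length v}. ?P (take p v @ u @ drop p v))"
        using nonneg by (intro sum_nonneg) auto
      moreover have "(\<Sum>p\<in>{0..length v}. ennreal (?P (take p v @ u @ drop p v)))
          = ennreal (\<Sum>p\<in>{0..length v}. ?P (take p v @ u @ drop p v))"
        using nonneg by (intro sum_ennreal) auto
      ultimately show ?thesis by (simp only:) (rule divide_ennreal, auto)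
    qed
    also have "\<dots> \<le> ennreal (?P v)"
      using sum_nesting_potential_insertions_le[OF assms(1) u]
      by (intro ennreal_leI) (simp add: field_simps)
    finally show ?thesis .
  qed
  have "(\<integral>\<^sup>+ v'. ennreal (?P v') \<partial>random_transformation PI v)
      = (\<integral>\<^sup>+ u. \<integral>\<^sup>+ p. ennreal (?P (take p v @ u @ drop p v)) \<partial>pmf_of_set {0..length v} \<partial>PI)"
    by (simp add: random_transformation_def)
  also have "\<dots> \<le> (\<integral>\<^sup>+ u. ennreal (?P v) \<partial>PI)"
    using inner PI by (intro nn_integral_mono_AE) (auto simp: AE_measure_pmf_iff)
  finally show ?thesis by simp
qed

section \<open>Iterating insertions and the tail of the nesting depth\<close>

lemma nested_random_transformation:
  assumes "nested X R H ds v" "set_pmf PI \<subseteq> elementary_identities X R"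
    and "\<forall>u\<in>elementary_identities X R. length u \<le> M"
    and "v' \<in> set_pmf (random_transformation PI v)"
  shows "\<exists>ds. nested X R H ds v'" "length v' \<le> length v + M"
proof -
  obtain u p where u: "u \<in> elementary_identities X R" "p \<le> length v" "v' = take p v @ u @ drop p v"
    using assms(2,4) by (auto simp: random_transformation_def)
  show "\<exists>ds. nested X R H ds v'"
    using nested_insert[OF assms(1) u(1) _ u(2)] assms(1) u(3) by (cases "u = []") auto
  show "length v' \<le> length v + M" using u assms(3) by auto
qed

lemma nested_random_transformations:
  assumes "nested X R H ds v" "set_pmf PI \<subseteq> elementary_identities X R"
    and "\<forall>u\<in>elementary_identities X R. length u \<le> M"
    and "v' \<in> set_pmf (random_transformations PI v n)"
  shows "(\<exists>ds. nested X R H ds v') \<and> length v' \<le> length v + n * M"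
  using assms(4)
proof (induction n arbitrary: v')
  case 0
  then show ?case using assms(1) by auto
next
  case (Suc n)
  then obtain v1 where v1: "v1 \<in> set_pmf (random_transformations PI v n)"
    "v' \<in> set_pmf (random_transformation PI v1)"
    by auto
  obtain ds1 where "nested X R H ds1 v1" "length v1 \<le> length v + n * M"
    using Suc.IH v1 by blast
  then show ?case
    using nested_random_transformation[OF _ assms(2,3) v1(2)] by fastforce
qed

lemma nn_integral_random_transformations_le:
  assumes "nested X R H ds v" "set_pmf PI \<subseteq> elementary_identities X R"
    and "\<forall>u\<in>elementary_identities X R. length u \<le> M"
  shows "(\<integral>\<^sup>+ v'. ennreal (nesting_potential X R H v') \<partial>random_transformations PI v n)
    \<le> ennreal (nesting_potential X R H v)"
proof (induction n)
  case (Suc n)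
  have "(\<integral>\<^sup>+ v'. ennreal (nesting_potential X R H v') \<partial>random_transformations PI v (Suc n))
      = (\<integral>\<^sup>+ v1. \<integral>\<^sup>+ v'. ennreal (nesting_potential X R H v') \<partial>random_transformation PI v1
          \<partial>random_transformations PI v n)"
    by simp
  also have "\<dots> \<le> (\<integral>\<^sup>+ v1. ennreal (nesting_potential X R H v1) \<partial>random_transformations PI v n)"
    using nested_random_transformations[OF assms] nn_integral_random_transformation_le[OF _ assms(2)]
    by (intro nn_integral_mono_AE) (simp add: AE_measure_pmf_iff, blast)
  finally show ?case using Suc by simp
qed simp

text \<open>Nestings belong to unreduced words, so probabilities are estimated here and transferred
  along free reduction.\<close>

definition random_unreduced_word :: "'x word pmf \<Rightarrow> 'x word pmf \<Rightarrow> nat \<Rightarrow> nat \<Rightarrow> 'x word pmf" where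
  "random_unreduced_word PI PH k n =
    do {vs \<leftarrow> replicate_pmf k PH; random_transformations PI (concat vs) n}"

text \<open>Both nested procedures reduce their output, hence the double reduction.\<close>

lemma random_subgroup_word_eq_map:
  "random_subgroup_word PI PH k n =
    map_pmf (\<lambda>v. free_reduce (free_reduce v)) (random_unreduced_word PI PH k n)"
  by (simp add: random_subgroup_word_def random_unreduced_word_def random_equal_word_def
      map_pmf_def bind_assoc_pmf bind_return_pmf)

lemma length_concat_le:
  "\<forall>v\<in>set vs. length v \<le> M \<Longrightarrow> length (concat vs) \<le> length vs * M"
  by (induction vs) auto

lemma random_unreduced_word_support:
  assumes PI: "set_pmf PI \<subseteq> elementary_identities X R" and PH: "set_pmf PH \<subseteq> H \<union> inv_word ` H"
    and M: "\<forall>u\<in>elementary_identities X R. length u \<le> M" "\<forall>h\<in>H. length h \<le> M"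
    and v: "v \<in> set_pmf (random_unreduced_word PI PH k n)"
  shows "(\<exists>ds. nested X R H ds v) \<and> length v \<le> (k + n) * M"
proof -
  obtain vs where vs: "vs \<in> set_pmf (replicate_pmf k PH)"
    "v \<in> set_pmf (random_transformations PI (concat vs) n)"
    using v by (auto simp: random_unreduced_word_def)
  then have "set vs \<subseteq> H \<union> inv_word ` H" "length vs = k"
    using PH by (auto simp: set_replicate_pmf)
  moreover from this have "length (concat vs) \<le> k * M"
    using length_concat_le[of vs M] M(2) by force
  ultimately show ?thesis
    using nested_random_transformations[OF nested.product PI M(1) vs(2)]
    by (fastforce simp: algebra_simps)
qed

text \<open>All N gaps of a product have depth 0, so the weight is at most N and the potential at
  most N / N^2. The bound does not depend on the number of factors.\<close>

lemma nesting_potential_product_le: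
  assumes "set vs \<subseteq> H \<union> inv_word ` H"
  shows "nesting_potential X R H (concat vs) \<le> 1"
proof -
  let ?N = "real (length (concat vs)) + 1"
  have "nesting_weight X R H (concat vs) \<le> ?N"
    using nesting_weight_le[OF nested.product[OF assms], of X R]
    by (simp add: depth_weight_def sum_list_replicate del: length_concat)
  also have "?N * 1 \<le> ?N * ?N" by (intro mult_left_mono) auto
  finally show ?thesis
    unfolding nesting_potential_def by (simp add: power2_eq_square del: length_concat)
qed

lemma nn_integral_random_unreduced_word_le:
  assumes PI: "set_pmf PI \<subseteq> elementary_identities X R" and PH: "set_pmf PH \<subseteq> H \<union> inv_word ` H"
    and M: "\<forall>u\<in>elementary_identities X R. length u \<le> M"
  shows "(\<integral>\<^sup>+ v. ennreal (nesting_potential X R H v) \<partial>random_unreduced_word PI PH k n) \<le> 1"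
proof -
  have "(\<integral>\<^sup>+ v. ennreal (nesting_potential X R H v) \<partial>random_transformations PI (concat vs) n) \<le> 1"
    if "vs \<in> set_pmf (replicate_pmf k PH)" for vs
  proof -
    have vs: "set vs \<subseteq> H \<union> inv_word ` H"
      using that PH by (auto simp: set_replicate_pmf)
    have "ennreal (nesting_potential X R H (concat vs)) \<le> 1"
      using nesting_potential_product_le[OF vs] by (simp add: ennreal_le_1)
    with nn_integral_random_transformations_le[OF nested.product[OF vs] PI M] show ?thesis
      by (rule order_trans)
  qed
  then have "(\<integral>\<^sup>+ v. ennreal (nesting_potential X R H v) \<partial>random_unreduced_word PI PH k n)
      \<le> (\<integral>\<^sup>+ vs. 1 \<partial>replicate_pmf k PH)"
    unfolding random_unreduced_word_def nn_integral_bind_pmf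
    by (intro nn_integral_mono_AE) (auto simp: AE_measure_pmf_iff)
  then show ?thesis by simp
qed

text \<open>Markov's inequality: as the length is at most (k + n) M, a weight of at least 2^d forces
  the potential to be at least 2^d / ((k + n) M + 1)^2, while its mean is at most 1.\<close>

lemma prob_nesting_weight_ge:
  assumes PI: "set_pmf PI \<subseteq> elementary_identities X R" and PH: "set_pmf PH \<subseteq> H \<union> inv_word ` H"
    and M: "\<forall>u\<in>elementary_identities X R. length u \<le> M" "\<forall>h\<in>H. length h \<le> M"
  shows "measure_pmf.prob (random_unreduced_word PI PH k n) {v. 2 ^ d \<le> nesting_weight X R H v}
    \<le> (real ((k + n) * M) + 1)\<^sup>2 / 2 ^ d"
proof -
  let ?Q = "random_unreduced_word PI PH k n" and ?B = "real ((k + n) * M) + 1"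
  let ?A = "{v. 2 ^ d \<le> nesting_weight X R H v}" and ?c = "(real ((k + n) * M) + 1)\<^sup>2 / 2 ^ d"
  have "emeasure ?Q ?A = (\<integral>\<^sup>+ v. indicator ?A v \<partial>?Q)"
    by simp
  also have "\<dots> \<le> (\<integral>\<^sup>+ v. ennreal ?c * ennreal (nesting_potential X R H v) \<partial>?Q)"
  proof (rule nn_integral_mono_AE, unfold AE_measure_pmf_iff, rule ballI)
    fix v assume "v \<in> set_pmf ?Q"
    then have len: "real (length v) + 1 \<le> ?B"
      using random_unreduced_word_support[OF PI PH M] by (simp del: of_nat_mult of_nat_add)
    show "indicator ?A v \<le> ennreal ?c * ennreal (nesting_potential X R H v)"
    proof (cases "v \<in> ?A")
      case True
      have "1 = 2 ^ d / ?B\<^sup>2 * ?c" by (simp add: add_nonneg_eq_0_iff)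
      also have "2 ^ d / ?B\<^sup>2 * ?c \<le> nesting_potential X R H v * ?c"
        unfolding nesting_potential_def
      proof (intro mult_right_mono frac_le power_mono)
        show "2 ^ d \<le> nesting_weight X R H v" using True by simp
        show "real (length v) + 1 \<le> ?B" by (rule len)
        have "(0::real) \<le> 2 ^ d" by simp
        also have "\<dots> \<le> nesting_weight X R H v" using True by simp
        finally show "0 \<le> nesting_weight X R H v" .
      qed auto
      finally have "1 \<le> ?c * nesting_potential X R H v" by (simp add: mult.commute)
      then show ?thesis
        using True by (subst ennreal_mult'[symmetric]) auto
    qed simp
  qed
  also have "\<dots> = ennreal ?c * (\<integral>\<^sup>+ v. ennreal (nesting_potential X R H v) \<partial>?Q)"
    by (rule nn_integral_cmult) simp
  also have "\<dots> \<le> ennreal ?c * 1"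
    by (intro mult_left_mono nn_integral_random_unreduced_word_le[OF PI PH M(1)]) simp
  finally show ?thesis
    by (simp add: measure_pmf.emeasure_eq_measure)
qed

text \<open>In an optimal nesting, a single gap of depth \<open>n\<close> or more would already
  contribute 2^n.\<close>

lemma nested_depth_less:
  assumes "nested X R H ds v" "nesting_weight X R H v < 2 ^ n"
  shows "\<exists>ds. nested X R H ds v \<and> (\<forall>d\<in>set ds. d < n)"
proof -
  obtain ds' where ds': "nested X R H ds' v" "nesting_weight X R H v = depth_weight ds'"
    using assms(1) by (rule nesting_weight_attained)
  have "d < n" if "d \<in> set ds'" for d
  proof -
    have "2 ^ d \<le> depth_weight ds'"
      unfolding depth_weight_def using that by (intro member_le_sum_list) auto
    also have "\<dots> < 2 ^ n" using assms(2) ds'(2) by simp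
    finally have "(2::real) ^ d < 2 ^ n" .
    then show ?thesis by (rule power_less_imp_less_exp[rotated]) simp
  qed
  with ds' show ?thesis by blast
qed


section \<open>Running time\<close>

text \<open>The initial graph need not be folded, so foldedness is claimed only after the first
  round.\<close>

lemma solver_graph_layered:
  assumes fold: "\<forall>\<Gamma>\<in>xdigraphs X. is_stallings_folding \<Gamma> (folding A \<Gamma>)"
    and "finite R" "\<forall>r\<in>R. set r \<subseteq> X \<times> UNIV" "finite H" "\<forall>h\<in>H. set h \<subseteq> X \<times> UNIV"
    and "set w \<subseteq> X \<times> UNIV"
  shows "solver_graph A R H w i \<in> xdigraphs X \<and>
    (\<exists>W. layered R H w i (solver_graph A R H w i) W) \<and>
    (i > 0 \<longrightarrow> folded (edges (solver_graph A R H w i)))"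
proof (induction i)
  case 0
  then show ?case
    using initial_graph_xdigraphs[of H X w] layered_initial_graph[of H w X R] assms by auto
next
  case (Suc i)
  let ?C = "completion R (solver_graph A R H w i)"
  have C: "?C \<in> xdigraphs X"
    using Suc assms(2,3) by (intro completion_xdigraphs) auto
  then have "is_stallings_folding ?C (folding A ?C)" using fold by blast
  then obtain f where f: "folding A ?C = map_vertices f ?C" "folded (edges (folding A ?C))"
    by (rule stallings_folding_map)
  obtain W where "layered R H w i (solver_graph A R H w i) W" using Suc by blast
  then have "\<exists>W'. layered R H w (Suc i) (folding A ?C) W'"
    using f(1) C by (rule layered_completion)
  moreover have "folding A ?C \<in> xdigraphs X"
    unfolding f(1) using C by (rule map_vertices_xdigraphs)
  ultimately show ?case using f(2) by simp
qed

section \<open>Growth of the graph\<close>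

lemma loop_inner_verts:
  "path_verts (loop p r) r \<subseteq> insert (Old p) (loop p r ` {1..<length r})"
proof
  fix x assume "x \<in> path_verts (loop p r) r"
  then obtain i where i: "i \<le> length r" "x = loop p r i" by (auto simp: path_verts_def)
  show "x \<in> insert (Old p) (loop p r ` {1..<length r})"
  proof (cases "i = 0 \<or> i = length r")
    case True
    then show ?thesis using i by (auto simp: loop_def)
  next
    case False
    then show ?thesis using i by auto
  qed
qed

text \<open>Each vertex is kept and gains at most |r| - 1 inner vertices per relator r. The letter
  saved on the nonempty \<open>r0\<close> pays for the vertex itself, which gives the factor L(R)
  instead of L(R) + 1.\<close>

lemma card_verts_completion_le:
  assumes fin: "finite (verts \<Gamma>)" and R: "finite R" "r0 \<in> R" "r0 \<noteq> []"
  shows "card (verts (completion R \<Gamma>)) \<le> card (verts \<Gamma>) * total_length R"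
proof -
  let ?N = "\<lambda>p. \<Union>r\<in>R. loop p r ` {1..<length r}"
  have N: "finite (?N p)" "card (?N p) \<le> (\<Sum>r\<in>R. length r - 1)" for p :: "'a vertex"
  proof -
    show "finite (?N p)" using R by auto
    have "card (?N p) \<le> (\<Sum>r\<in>R. card (loop p r ` {1..<length r}))"
      by (rule card_UN_le) (use R in auto)
    also have "\<dots> \<le> (\<Sum>r\<in>R. length r - 1)"
      by (intro sum_mono order_trans[OF card_image_le]) auto
    finally show "card (?N p) \<le> (\<Sum>r\<in>R. length r - 1)" .
  qed
  have "verts (completion R \<Gamma>) \<subseteq> Old ` verts \<Gamma> \<union> (\<Union>p\<in>verts \<Gamma>. ?N p)"
    using loop_inner_verts by (fastforce simp: completion_simps)
  then have "card (verts (completion R \<Gamma>)) \<le> card (Old ` verts \<Gamma> \<union> (\<Union>p\<in>verts \<Gamma>. ?N p))"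
    using fin N by (intro card_mono) auto
  also have "\<dots> \<le> card (Old ` verts \<Gamma>) + card (\<Union>p\<in>verts \<Gamma>. ?N p)"
    by (rule card_Un_le)
  also have "\<dots> \<le> card (verts \<Gamma>) + (\<Sum>p\<in>verts \<Gamma>. card (?N p))"
    using fin by (intro add_mono card_image_le card_UN_le)
  also have "\<dots> \<le> card (verts \<Gamma>) + card (verts \<Gamma>) * (\<Sum>r\<in>R. length r - 1)"
    using sum_bounded_above[of "verts \<Gamma>" "\<lambda>p. card (?N p)"] N by simp
  also have "\<dots> = card (verts \<Gamma>) * (1 + (\<Sum>r\<in>R. length r - 1))"
    by simp
  also have "1 + (\<Sum>r\<in>R. length r - 1) \<le> total_length R"
    unfolding total_length_def Suc_eq_plus1_left[symmetric] Suc_le_eq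
    by (rule sum_strict_mono_ex1) (use R in \<open>auto intro!: bexI[of _ r0]\<close>)
  finally show ?thesis by simp
qed

lemma card_path_edges_le: "card (path_edges f w) \<le> length w"
  unfolding path_edges_def by (rule order_trans[OF card_image_le]) auto

text \<open>New edges are charged to vertices rather than to old edges; summed over the rounds, this
  costs a factor linear in their number.\<close>

lemma card_edges_completion_le:
  assumes fin: "finite (verts \<Gamma>)" "finite R" "finite (edges \<Gamma>)"
  shows "card (edges (completion R \<Gamma>)) \<le> card (edges \<Gamma>) + card (verts \<Gamma>) * total_length R"
proof -
  have "card (\<Union>r\<in>R. path_edges (loop p r) r) \<le> total_length R" for p :: "'a vertex"
    unfolding total_length_def
    by (rule order_trans[OF card_UN_le[OF fin(2)]]) (intro sum_mono card_path_edges_le)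
  then have "(\<Sum>p\<in>verts \<Gamma>. card (\<Union>r\<in>R. path_edges (loop p r) r)) \<le> card (verts \<Gamma>) * total_length R"
    using sum_bounded_above[of "verts \<Gamma>" "\<lambda>p. card (\<Union>r\<in>R. path_edges (loop p r) r)"] by simp
  then have "card (\<Union>p\<in>verts \<Gamma>. \<Union>r\<in>R. path_edges (loop p r) r) \<le> card (verts \<Gamma>) * total_length R"
    using card_UN_le[OF fin(1), of "\<lambda>p. \<Union>r\<in>R. path_edges (loop p r) r"] by linarith
  then show ?thesis
    unfolding completion_simps using fin(3)
    by (intro order_trans[OF card_Un_le] add_mono card_image_le)
qed

lemma finite_edges_xdigraph:
  assumes "finite X" "\<Gamma> \<in> xdigraphs X"
  shows "finite (edges \<Gamma>)"
  using assms finite_subset[of "edges \<Gamma>" "verts \<Gamma> \<times> X \<times> verts \<Gamma>"] by (auto simp: xdigraphs_def)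

text \<open>A path has one vertex more than letters; \<open>card H + 1\<close> allows for this on
  every petal and on the stem.\<close>

definition input_size :: "'x word set \<Rightarrow> 'x word \<Rightarrow> nat" where
  "input_size H w = length w + total_length H + card H + 1"

lemma card_initial_graph_le:
  assumes "finite H"
  shows "card (verts (initial_graph H w)) \<le> input_size H w"
    and "card (edges (initial_graph H w)) \<le> input_size H w"
proof -
  have "card (path_verts f v) \<le> Suc (length v)" for f :: "nat \<Rightarrow> 'a vertex" and v :: "'a word"
    unfolding path_verts_def by (rule order_trans[OF card_image_le]) auto
  then have "card (path_verts stem w) + (\<Sum>h\<in>H. card (path_verts (petal h) h))
      \<le> Suc (length w) + (\<Sum>h\<in>H. Suc (length h))"
    by (intro add_mono sum_mono)
  then show "card (verts (initial_graph H w)) \<le> input_size H w"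
    using card_Un_le[of "path_verts stem w" "\<Union>h\<in>H. path_verts (petal h) h"]
      card_UN_le[OF assms, of "\<lambda>h. path_verts (petal h) h"]
    by (simp add: initial_graph_def input_size_def total_length_def sum_Suc)
  have "card (path_edges stem w) + (\<Sum>h\<in>H. card (path_edges (petal h) h)) \<le> length w + (\<Sum>h\<in>H. length h)"
    by (intro add_mono sum_mono card_path_edges_le)
  then show "card (edges (initial_graph H w)) \<le> input_size H w"
    using card_Un_le[of "path_edges stem w" "\<Union>h\<in>H. path_edges (petal h) h"]
      card_UN_le[OF assms, of "\<lambda>h. path_edges (petal h) h"]
    by (simp add: initial_graph_def input_size_def total_length_def)
qed

lemma solver_graph_size_le:
  assumes fold: "\<forall>\<Gamma>\<in>xdigraphs X. is_stallings_folding \<Gamma> (folding A \<Gamma>)"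
    and "finite X" and R: "finite R" "\<forall>r\<in>R. set r \<subseteq> X \<times> UNIV" "r0 \<in> R" "r0 \<noteq> []"
    and H: "finite H" "\<forall>h\<in>H. set h \<subseteq> X \<times> UNIV" and w: "set w \<subseteq> X \<times> UNIV"
  shows "i \<le> D \<Longrightarrow> graph_size (solver_graph A R H w i) \<le> (D + 2) * input_size H w * total_length R ^ D"
    and "i < D \<Longrightarrow> graph_size (completion R (solver_graph A R H w i))
      \<le> (D + 2) * input_size H w * total_length R ^ D"
proof -
  let ?\<Gamma> = "solver_graph A R H w" and ?L = "total_length R" and ?B = "input_size H w"
  have G: "?\<Gamma> i \<in> xdigraphs X" for i
    using solver_graph_layered[OF fold R(1,2) H w] by blast
  then have fin: "finite (verts (?\<Gamma> i))" "finite (edges (?\<Gamma> i))" for i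
    using finite_edges_xdigraph[OF \<open>finite X\<close>] by (auto simp: xdigraphs_def)
  have "1 \<le> length r0" using R(4) by (cases r0) auto
  also have "length r0 \<le> ?L" unfolding total_length_def using R by (intro member_le_sum) auto
  finally have L: "1 \<le> ?L" .
  have C: "completion R (?\<Gamma> i) \<in> xdigraphs X" for i
    using G R(1,2) by (rule completion_xdigraphs)
  have finC: "finite (verts (completion R (?\<Gamma> i)))" "finite (edges (completion R (?\<Gamma> i)))" for i
    using finite_edges_xdigraph[OF \<open>finite X\<close> C] C by (auto simp: xdigraphs_def)
  have shrink: "card (verts (?\<Gamma> (Suc i))) \<le> card (verts (completion R (?\<Gamma> i)))"
    "card (edges (?\<Gamma> (Suc i))) \<le> card (edges (completion R (?\<Gamma> i)))" for i
  proof -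
    obtain f where "?\<Gamma> (Suc i) = map_vertices f (completion R (?\<Gamma> i))"
      using fold C[of i] stallings_folding_map[of "completion R (?\<Gamma> i)" "?\<Gamma> (Suc i)"] by auto
    then show "card (verts (?\<Gamma> (Suc i))) \<le> card (verts (completion R (?\<Gamma> i)))"
      "card (edges (?\<Gamma> (Suc i))) \<le> card (edges (completion R (?\<Gamma> i)))"
      using finC[of i] by (simp_all add: card_image_le)
  qed
  have V: "card (verts (?\<Gamma> i)) \<le> ?B * ?L ^ i" for i
  proof (induction i)
    case 0
    then show ?case using card_initial_graph_le(1)[OF H(1)] by simp
  next
    case (Suc i)
    have "card (verts (?\<Gamma> (Suc i))) \<le> card (verts (?\<Gamma> i)) * ?L"
      using shrink(1) card_verts_completion_le[OF fin(1) R(1,3,4)] by (rule order_trans)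
    also have "\<dots> \<le> ?B * ?L ^ i * ?L" using Suc by (rule mult_right_mono) simp
    finally show ?case by (simp add: mult_ac)
  qed
  have E: "card (edges (?\<Gamma> i)) \<le> ?B + i * (?B * ?L ^ i)" for i
  proof (induction i)
    case 0
    then show ?case using card_initial_graph_le(2)[OF H(1)] by simp
  next
    case (Suc i)
    have "card (edges (?\<Gamma> (Suc i))) \<le> card (edges (?\<Gamma> i)) + card (verts (?\<Gamma> i)) * ?L"
      using shrink(2) card_edges_completion_le[OF fin(1) R(1) fin(2)] by (rule order_trans)
    also have "\<dots> \<le> (?B + i * (?B * ?L ^ i)) + ?B * ?L ^ i * ?L"
      using Suc V[of i] by (intro add_mono mult_right_mono) auto
    also have "\<dots> \<le> (?B + i * (?B * ?L ^ Suc i)) + ?B * ?L ^ Suc i"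
      using L by (auto intro!: mult_left_mono simp: mult_ac)
    finally show ?case by simp
  qed
  have powL: "?L ^ j \<le> ?L ^ D" if "j \<le> D" for j
    using that L by (rule power_increasing)
  have BL: "?B \<le> ?B * ?L ^ D" using L by simp
  \<comment> \<open>For a solver graph the three summands pay for the vertices, the initial edges
    and the edges added in at most \<open>D\<close> rounds. For a completion they pay for its
    vertices, its new edges and the edges already present.\<close>
  have split: "(D + 2) * ?B * ?L ^ D = ?B * ?L ^ D + (?B * ?L ^ D + D * (?B * ?L ^ D))"
    by (simp add: algebra_simps)
  show "graph_size (?\<Gamma> i) \<le> (D + 2) * ?B * ?L ^ D" if "i \<le> D"
  proof -
    have B: "?B * ?L ^ i \<le> ?B * ?L ^ D" using powL[OF that] by simp
    then have "i * (?B * ?L ^ i) \<le> D * (?B * ?L ^ D)" by (rule mult_le_mono[OF that])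
    then show ?thesis
      using B V[of i] E[of i] BL unfolding split graph_size_def by linarith
  qed
  show "graph_size (completion R (?\<Gamma> i)) \<le> (D + 2) * ?B * ?L ^ D" if "i < D"
  proof -
    have "?B * ?L ^ Suc i \<le> ?B * ?L ^ D" using powL[of "Suc i"] that by (intro mult_left_mono) auto
    moreover have "card (verts (?\<Gamma> i)) * ?L \<le> ?B * ?L ^ Suc i"
      using mult_right_mono[OF V[of i], of ?L] by (simp add: mult_ac)
    ultimately have VL: "card (verts (?\<Gamma> i)) * ?L \<le> ?B * ?L ^ D" by linarith
    have "?B * ?L ^ i \<le> ?B * ?L ^ D" using powL[of i] that by simp
    then have "Suc i * (?B * ?L ^ i) \<le> D * (?B * ?L ^ D)"
      using that by (intro mult_le_mono[of "Suc i" D]) simp_all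
    moreover have "Suc i * (?B * ?L ^ i) = ?B * ?L ^ i + i * (?B * ?L ^ i)" by simp
    moreover have "?B \<le> ?B * ?L ^ i" using L by simp
    ultimately have "card (edges (?\<Gamma> i)) \<le> D * (?B * ?L ^ D)" using E[of i] by linarith
    then show ?thesis
      using VL card_verts_completion_le[OF fin(1)[of i] R(1,3,4)]
        card_edges_completion_le[OF fin(1)[of i] R(1) fin(2)]
      unfolding split graph_size_def by linarith
  qed
qed

text \<open>A form monotone in the size, the constant and the exponent, so that the five costs of an
  implementation can share one bound.\<close>

lemma soft_O_bound:
  assumes "g \<in> soft_O A f" "\<forall>a\<in>A. 0 \<le> f a"
  obtains K :: real and m :: nat where "0 \<le> K"
    "\<And>a S K' m'. a \<in> A \<Longrightarrow> f a \<le> S \<Longrightarrow> 1 \<le> S \<Longrightarrow> K \<le> K' \<Longrightarrow> m \<le> m' \<Longrightarrow>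
      g a \<le> K' * S * ln (2 + S) ^ m'"
proof -
  obtain K m where K: "\<And>a. a \<in> A \<Longrightarrow> \<bar>g a\<bar> \<le> K * max 1 (f a) * ln (2 + f a) ^ m"
    using assms(1) by (auto simp: soft_O_def)
  show ?thesis
  proof (rule that[of "\<bar>K\<bar>" m])
    fix a S K' m' assume a: "a \<in> A" "f a \<le> S" "1 \<le> S" "\<bar>K\<bar> \<le> K'" "m \<le> m'"
    have "0 \<le> f a" using a assms(2) by blast
    \<comment> \<open>Since e \<le> 3 \<le> 2 + S, the logarithm is at least 1 and raising its
      exponent only weakens the bound.\<close>
    have ln3: "1 \<le> ln (2 + S)"
    proof -
      have "exp 1 \<le> 2 + S" using exp_le a by linarith
      then show ?thesis using a by (simp add: ln_ge_iff)
    qed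
    have "g a \<le> K * max 1 (f a) * ln (2 + f a) ^ m" using K[OF a(1)] by linarith
    also have "\<dots> \<le> K' * S * ln (2 + S) ^ m"
      using a \<open>0 \<le> f a\<close> by (intro mult_mono power_mono) auto
    also have "\<dots> \<le> K' * S * ln (2 + S) ^ m'"
      using a ln3 by (intro mult_left_mono power_increasing) auto
    finally show "g a \<le> K' * S * ln (2 + S) ^ m'" .
  qed simp
qed

text \<open>The solver stops at the first exit, hence within \<open>D\<close> rounds, and every
  graph met has size at most \<open>S\<close>. The constants are chosen before the word, so they are
  uniform in it.\<close>

lemma running_time_le:
  assumes impl: "implements_solver X R H A"
    and "finite X" and R: "finite R" "\<forall>r\<in>R. set r \<subseteq> X \<times> UNIV" "r0 \<in> R" "r0 \<noteq> []"
    and H: "finite H" "\<forall>h\<in>H. set h \<subseteq> X \<times> UNIV"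
  obtains K :: real and m :: nat where "0 \<le> K"
    "\<And>w D S. w \<in> carrier (free_group X) \<Longrightarrow> exits_at A R H w D \<Longrightarrow>
      real ((D + 2) * input_size H w * total_length R ^ D) \<le> S \<Longrightarrow>
      running_time A R H w \<le> ereal (3 * (real D + 1) * (K * S * ln (2 + S) ^ m))"
proof -
  note I = impl[unfolded implements_solver_def]
  have fold: "\<forall>\<Gamma>\<in>xdigraphs X. is_stallings_folding \<Gamma> (folding A \<Gamma>)" using I by blast
  obtain K1 m1 where K1: "0 \<le> K1"
    "\<And>w S K' m'. w \<in> carrier (free_group X) \<Longrightarrow> real (length w + total_length H) \<le> S \<Longrightarrow> 1 \<le> S \<Longrightarrow>
      K1 \<le> K' \<Longrightarrow> m1 \<le> m' \<Longrightarrow> real (time_init A w) \<le> K' * S * ln (2 + S) ^ m'"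
    by (rule soft_O_bound[of "\<lambda>w. real (time_init A w)"]) (use I in auto)
  obtain K2 m2 where K2: "0 \<le> K2"
    "\<And>\<Gamma> S K' m'. \<Gamma> \<in> xdigraphs X \<Longrightarrow> real (graph_size \<Gamma>) \<le> S \<Longrightarrow> 1 \<le> S \<Longrightarrow>
      K2 \<le> K' \<Longrightarrow> m2 \<le> m' \<Longrightarrow> real (time_test A \<Gamma>) \<le> K' * S * ln (2 + S) ^ m'"
    by (rule soft_O_bound[of "\<lambda>\<Gamma>. real (time_test A \<Gamma>)"]) (use I in auto)
  obtain K3 m3 where K3: "0 \<le> K3"
    "\<And>\<Gamma> S K' m'. \<Gamma> \<in> xdigraphs X \<Longrightarrow> real (graph_size (completion R \<Gamma>)) \<le> S \<Longrightarrow> 1 \<le> S \<Longrightarrow>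
      K3 \<le> K' \<Longrightarrow> m3 \<le> m' \<Longrightarrow> real (time_complete A \<Gamma>) \<le> K' * S * ln (2 + S) ^ m'"
    by (rule soft_O_bound[of "\<lambda>\<Gamma>. real (time_complete A \<Gamma>)"]) (use I in auto)
  obtain K4 m4 where K4: "0 \<le> K4"
    "\<And>\<Gamma> S K' m'. \<Gamma> \<in> xdigraphs X \<Longrightarrow> real (graph_size \<Gamma>) \<le> S \<Longrightarrow> 1 \<le> S \<Longrightarrow>
      K4 \<le> K' \<Longrightarrow> m4 \<le> m' \<Longrightarrow> real (time_fold A \<Gamma>) \<le> K' * S * ln (2 + S) ^ m'"
    by (rule soft_O_bound[of "\<lambda>\<Gamma>. real (time_fold A \<Gamma>)"]) (use I in auto)
  obtain K5 m5 where K5: "0 \<le> K5"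
    "\<And>\<Gamma> S K' m'. \<Gamma> \<in> xdigraphs X \<Longrightarrow> real (graph_size \<Gamma>) \<le> S \<Longrightarrow> 1 \<le> S \<Longrightarrow>
      K5 \<le> K' \<Longrightarrow> m5 \<le> m' \<Longrightarrow> real (time_return A \<Gamma>) \<le> K' * S * ln (2 + S) ^ m'"
    by (rule soft_O_bound[of "\<lambda>\<Gamma>. real (time_return A \<Gamma>)"]) (use I in auto)
  define K m where "K = K1 + K2 + K3 + K4 + K5" and "m = m1 + m2 + m3 + m4 + m5"
  have Kge: "K1 \<le> K" "K2 \<le> K" "K3 \<le> K" "K4 \<le> K" "K5 \<le> K"
    and mge: "m1 \<le> m" "m2 \<le> m" "m3 \<le> m" "m4 \<le> m" "m5 \<le> m"
    using K1(1) K2(1) K3(1) K4(1) K5(1) by (simp_all add: K_def m_def)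
  show ?thesis
  proof (rule that[of K m])
    show "0 \<le> K" using Kge K1(1) by linarith
    fix w D S
    assume w: "w \<in> carrier (free_group X)" and exits: "exits_at A R H w D"
      and S: "real ((D + 2) * input_size H w * total_length R ^ D) \<le> S"
    let ?\<Gamma> = "solver_graph A R H w"
    define N where "N = (LEAST i. exits_at A R H w i)"
    define U where "U = K * S * ln (2 + S) ^ m"
    have wX: "set w \<subseteq> X \<times> UNIV" using w by (rule carrier_free_groupD(1))
    have "N \<le> D" unfolding N_def using exits by (rule Least_le)
    have G: "?\<Gamma> i \<in> xdigraphs X" for i
      using solver_graph_layered[OF fold R(1,2) H wX] by blast
    have C: "completion R (?\<Gamma> i) \<in> xdigraphs X" for i
      using G R(1,2) by (rule completion_xdigraphs)
    have size: "real (graph_size (?\<Gamma> i)) \<le> S" if "i \<le> D" for i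
      using solver_graph_size_le(1)[OF fold \<open>finite X\<close> R H wX that] S by linarith
    have sizeC: "real (graph_size (completion R (?\<Gamma> i))) \<le> S" if "i < D" for i
      using solver_graph_size_le(2)[OF fold \<open>finite X\<close> R H wX that] S by linarith
    have "1 \<le> length r0" using R(4) by (cases r0) auto
    also have "length r0 \<le> total_length R"
      unfolding total_length_def using R by (intro member_le_sum) auto
    finally have "1 \<le> total_length R ^ D" by (simp add: one_le_power)
    then have "1 * input_size H w * 1 \<le> (D + 2) * input_size H w * total_length R ^ D"
      by (intro mult_mono) auto
    then have "real (input_size H w) \<le> S"
      using S by linarith
    then have inS: "real (length w + total_length H) \<le> S" "1 \<le> S"
      by (simp_all add: input_size_def)
    have init: "real (time_init A w) \<le> U"
      unfolding U_def using K1(2)[OF w inS Kge(1) mge(1)] .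
    have step: "real (time_test A (?\<Gamma> i) + time_complete A (?\<Gamma> i) + time_fold A (completion R (?\<Gamma> i))) \<le> 3 * U"
      if "i < D" for i
      using K2(2)[OF G size inS(2) Kge(2) mge(2), of i] K3(2)[OF G sizeC inS(2) Kge(3) mge(3), of i]
        K4(2)[OF C sizeC inS(2) Kge(4) mge(4), of i] that
      unfolding U_def by simp
    have last: "real (time_test A (?\<Gamma> N)) \<le> U" "real (time_return A (?\<Gamma> N)) \<le> U"
      using K2(2)[OF G size inS(2) Kge(2) mge(2), of N] K5(2)[OF G size inS(2) Kge(5) mge(5), of N]
        \<open>N \<le> D\<close>
      unfolding U_def by auto
    have "0 \<le> U" using init of_nat_0_le_iff[of "time_init A w", where ?'a = real] by linarith
    have "real (\<Sum>i<N. time_test A (?\<Gamma> i) + time_complete A (?\<Gamma> i) + time_fold A (completion R (?\<Gamma> i)))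
        \<le> real (card {..<N}) * (3 * U)"
      unfolding of_nat_sum using \<open>N \<le> D\<close> by (intro sum_bounded_above step) auto
    also have "\<dots> \<le> real D * (3 * U)"
      using \<open>N \<le> D\<close> \<open>0 \<le> U\<close> by (intro mult_right_mono) auto
    finally have sum: "real (\<Sum>i<N. time_test A (?\<Gamma> i) + time_complete A (?\<Gamma> i) +
        time_fold A (completion R (?\<Gamma> i))) \<le> real D * (3 * U)" .
    have "running_time A R H w = ereal (real (time_init A w) +
        real (\<Sum>i<N. time_test A (?\<Gamma> i) + time_complete A (?\<Gamma> i) + time_fold A (completion R (?\<Gamma> i))) +
        real (time_test A (?\<Gamma> N)) + real (time_return A (?\<Gamma> N)))"
      using exits unfolding running_time_def Let_def N_def[symmetric] by (auto simp del: of_nat_sum)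
    \<comment> \<open>Three operations in each of at most \<open>D\<close> rounds, and three more
      for the set-up, the last test and the output.\<close>
    also have "\<dots> \<le> ereal (3 * (real D + 1) * U)"
      using init sum last by (simp add: algebra_simps del: of_nat_sum)
    finally show "running_time A R H w \<le> ereal (3 * (real D + 1) * (K * S * ln (2 + S) ^ m))"
      unfolding U_def .
  qed
qed

text \<open>The condition \<open>0 < D\<close> guarantees at least one round, after which the graph
  is folded.\<close>

lemma nested_exits_at:
  assumes impl: "implements_solver X R H A" and "finite R" and sym: "symmetrized X R"
    and H: "finite H" "H \<subseteq> carrier (free_group X)"
    and nst: "nested X R H ds v" "\<forall>d\<in>set ds. d < D" and "0 < D"
  shows "exits_at A R H (free_reduce (free_reduce v)) D"
    and "free_reduce (free_reduce v) \<in> MSP X R H"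
proof -
  have R: "R \<subseteq> carrier (free_group X)" using sym by (simp add: symmetrized_def)
  show msp: "free_reduce (free_reduce v) \<in> MSP X R H"
    using nested_imp_MSP[OF R H(2) nst(1)] by (simp add: free_reduce_reduced)
  let ?w = "free_reduce (free_reduce v)"
  have "set ?w \<subseteq> X \<times> UNIV" using msp by (intro carrier_free_groupD(1)) (simp add: MSP_def)
  moreover have "\<forall>r\<in>R. set r \<subseteq> X \<times> UNIV" "\<forall>h\<in>H. set h \<subseteq> X \<times> UNIV"
    using R H(2) carrier_free_groupD(1) by blast+
  ultimately obtain W where "layered R H ?w D (solver_graph A R H ?w D) W"
    "folded (edges (solver_graph A R H ?w D))"
    using solver_graph_layered[of X A R H ?w D] impl \<open>finite R\<close> H(1) \<open>0 < D\<close>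
    unfolding implements_solver_def by blast
  then show "exits_at A R H ?w D"
    unfolding exits_at_def using layered_source_eq_target sym nst by blast
qed


text \<open>The lower bound pushes the depth threshold above twice the binary logarithm of n; the
  upper one limits the number of rounds to 9 ln n.\<close>

lemma exp_1_squared_bounds: "4 \<le> (exp (1::real))\<^sup>2" "(exp 1)\<^sup>2 \<le> (9::real)"
proof -
  have "2 \<le> exp (1::real)" using exp_ge_add_one_self[of "1::real"] by simp
  then show "4 \<le> (exp (1::real))\<^sup>2" using power_mono[of 2 "exp (1::real)" 2] by simp
  show "(exp (1::real))\<^sup>2 \<le> 9" using power_mono[OF exp_le, of 2] by simp
qed


section \<open>The generic time bound\<close>

text \<open>Since \<open>e\<^sup>2 ln 2 \<ge> 8/3 > 2\<close>, nesting depth \<open>depth_bound n\<close> is exceeded with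
  probability \<open>O(n\<^sup>2 / 2\<^bsup>depth_bound n\<^esup>) = o(1)\<close>.\<close>

definition depth_bound :: "nat \<Rightarrow> nat" where
  "depth_bound n = nat \<lfloor>(exp 1)\<^sup>2 * ln (real n)\<rfloor>"

lemma depth_bound_bounds:
  assumes "1 \<le> n"
  shows "real (depth_bound n) \<le> (exp 1)\<^sup>2 * ln (real n)"
    and "(exp 1)\<^sup>2 * ln (real n) \<le> real (depth_bound n) + 1"
proof -
  have "0 \<le> (exp 1)\<^sup>2 * ln (real n)" using assms by simp
  then show "real (depth_bound n) \<le> (exp 1)\<^sup>2 * ln (real n)"
    "(exp 1)\<^sup>2 * ln (real n) \<le> real (depth_bound n) + 1"
    unfolding depth_bound_def by linarith+
qed

lemma power_depth_bound_le:
  assumes "1 \<le> n" "1 \<le> (b::real)"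
  shows "b ^ depth_bound n \<le> real n powr ((exp 1)\<^sup>2 * ln b)"
proof -
  have "b ^ depth_bound n = b powr real (depth_bound n)"
    using assms by (simp add: powr_realpow)
  also have "\<dots> \<le> b powr ((exp 1)\<^sup>2 * ln (real n))"
    using assms depth_bound_bounds(1) by (intro powr_mono) auto
  also have "\<dots> = real n powr ((exp 1)\<^sup>2 * ln b)"
    using assms by (simp add: powr_def mult_ac)
  finally show ?thesis .
qed

text \<open>The exponent is 4 times 2/3, from e^2 \<ge> 4 and ln 2 \<ge> 2/3; the factor 2 makes up
  for rounding the depth down.\<close>

lemma two_power_depth_bound_ge:
  assumes "1 \<le> n"
  shows "real n powr (8/3) \<le> 2 * 2 ^ depth_bound n"
proof -
  have "4 * (2/3) \<le> (exp 1)\<^sup>2 * ln (2::real)"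
    using exp_1_squared_bounds(1) ln2_ge_two_thirds by (intro mult_mono) auto
  then have "real n powr (8/3) \<le> real n powr ((exp 1)\<^sup>2 * ln 2)"
    using assms by (intro powr_mono) auto
  also have "\<dots> = 2 powr ((exp 1)\<^sup>2 * ln (real n))"
    using assms by (simp add: powr_def mult_ac)
  also have "\<dots> \<le> 2 powr (real (depth_bound n) + 1)"
    using depth_bound_bounds(2)[OF assms] by (intro powr_mono) auto
  also have "\<dots> = 2 * 2 ^ depth_bound n"
    by (simp add: powr_add powr_realpow)
  finally show ?thesis .
qed

text \<open>The size is at most a constant times (2 + f)^2, so its logarithm is at most a constant
  times ln (2 + f). Two further logarithms come from the number of rounds and from the size itself.
  With D + 1 \<le> 10 ln (2 + f), the constant is 330 = 3 * 10 * 11.\<close>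

lemma soft_bound_absorb:
  fixes K c f :: real and D :: real and m :: nat
  assumes f: "1 \<le> f" and K: "0 \<le> K" and c: "1 \<le> c" and D: "0 \<le> D" "D \<le> 9 * ln (2 + f)"
  shows "3 * (D + 1) * (K * (11 * c * f * ln (2 + f)) * ln (2 + 11 * c * f * ln (2 + f)) ^ m)
    \<le> (330 * K * c * (ln (2 + 11 * c) + 2) ^ m) * max 1 f * ln (2 + f) ^ (m + 2)"
proof -
  define l where "l = ln (2 + f)"
  have l: "1 \<le> l"
    using exp_le f by (auto simp: l_def ln_ge_iff)
  have "l \<le> 2 + f"
    unfolding l_def using f by (intro order.trans[OF ln_le_minus_one]) auto
  have "2 + 11 * c * f * l \<le> (2 + 11 * c) * (2 + f)\<^sup>2"
  proof -
    have "f * l \<le> (2 + f) * (2 + f)" using f l \<open>l \<le> 2 + f\<close> by (intro mult_mono) auto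
    then have "11 * c * (f * l) \<le> 11 * c * (2 + f)\<^sup>2"
      using c by (intro mult_left_mono) (auto simp: power2_eq_square)
    moreover have "1 \<le> (2 + f)\<^sup>2" using f by (intro one_le_power) auto
    ultimately show ?thesis by (simp add: algebra_simps)
  qed
  moreover have pos: "0 \<le> 11 * c * f * l" using c f l by simp
  ultimately have "ln (2 + 11 * c * f * l) \<le> ln ((2 + 11 * c) * (2 + f)\<^sup>2)"
    using c f by (subst ln_le_cancel_iff) (auto intro!: mult_pos_pos)
  also have "\<dots> = ln (2 + 11 * c) + 2 * l"
    using c f by (simp add: ln_mult ln_realpow l_def)
  also have "\<dots> \<le> ln (2 + 11 * c) * l + 2 * l"
    using c l mult_left_mono[of 1 l "ln (2 + 11 * c)"] by simp
  finally have ln: "ln (2 + 11 * c * f * l) \<le> (ln (2 + 11 * c) + 2) * l"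
    by (simp add: algebra_simps)
  have "3 * (D + 1) * (K * (11 * c * f * l) * ln (2 + 11 * c * f * l) ^ m)
      \<le> 3 * (9 * l + l) * (K * (11 * c * f * l) * ((ln (2 + 11 * c) + 2) * l) ^ m)"
    using D l K c f ln pos
    by (intro mult_mono power_mono) (auto simp: l_def)
  also have "\<dots> = (330 * K * c * (ln (2 + 11 * c) + 2) ^ m) * f * l ^ (m + 2)"
    unfolding power_mult_distrib[of "ln (2 + 11 * c) + 2" l m]
    by (simp add: power_add power2_eq_square mult_ac)
  finally show ?thesis using f by (simp add: l_def max_def)
qed

theorem theoremD:
  fixes X :: "'x set" and R H :: "'x word set" and PI PH :: "'x word pmf"
    and A :: "'x implementation"
  assumes "finite X" and "finite R" and "symmetrized X R" and "\<exists>r\<in>R. r \<noteq> []"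
    and "finite H" and "H \<noteq> {}" and "H \<subseteq> carrier (free_group X)"
    and "set_pmf PI \<subseteq> elementary_identities X R"
    and "set_pmf PH \<subseteq> H \<union> inv_word ` H"
    and "implements_solver X R H A"
  shows "\<exists>T :: nat \<Rightarrow> nat \<Rightarrow> real.
    (\<lambda>(k, n). T k n) \<in> soft_O UNIV
      (\<lambda>(k, n). real (k + n) * real n powr ((exp 1)\<^sup>2 * ln (real (total_length R)))) \<and>
    (\<forall>k. (\<lambda>n. measure_pmf.prob (random_subgroup_word PI PH k n)
                {w \<in> MSP X R H. running_time A R H w \<le> ereal (T k n)})
          \<longlonglongrightarrow> 1)"
proof -
  let ?L = "real (total_length R)"
  obtain r0 where r0: "r0 \<in> R" "r0 \<noteq> []" using assms(4) by blast
  have Rc: "R \<subseteq> carrier (free_group X)" using assms(3) by (simp add: symmetrized_def)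
  have RX: "\<forall>r\<in>R. set r \<subseteq> X \<times> UNIV" and HX: "\<forall>h\<in>H. set h \<subseteq> X \<times> UNIV"
    using Rc assms(7) carrier_free_groupD(1) by blast+
  have len_R: "length r \<le> total_length R" if "r \<in> R" for r
    unfolding total_length_def using that assms(2) by (intro member_le_sum) auto
  have len_H: "length h \<le> total_length H" if "h \<in> H" for h
    unfolding total_length_def using that assms(5) by (intro member_le_sum) auto
  have "1 \<le> length r0" using r0 by (cases r0) auto
  then have L: "1 \<le> ?L" using len_R[OF r0(1)] by linarith
  define M where "M = 2 + total_length R + total_length H"
  have M: "\<forall>u\<in>elementary_identities X R. length u \<le> M" "\<forall>h\<in>H. length h \<le> M"
    using len_R len_H by (fastforce simp: elementary_identities_def M_def)+
  obtain K m where K: "0 \<le> K" and time: "\<And>w D S. w \<in> carrier (free_group X) \<Longrightarrow> exits_at A R H w D \<Longrightarrow>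
      real ((D + 2) * input_size H w * total_length R ^ D) \<le> S \<Longrightarrow>
      running_time A R H w \<le> ereal (3 * (real D + 1) * (K * S * ln (2 + S) ^ m))"
    using running_time_le[OF assms(10,1,2) RX r0 assms(5) HX] by metis
  define f where "f k n = real (k + n) * real n powr ((exp 1)\<^sup>2 * ln ?L)" for k n
  define c where "c = real (M + total_length H + card H + 1)"
  define K' where "K' = 330 * K * c * (ln (2 + 11 * c) + 2) ^ m"
  define T where "T k n = K' * max 1 (f k n) * ln (2 + f k n) ^ (m + 2)" for k n
  have c: "1 \<le> c" by (simp add: c_def)
  have f0: "0 \<le> f k n" for k n by (simp add: f_def)
  have K'0: "0 \<le> K'" using K c by (simp add: K'_def)
  have soft: "(\<lambda>(k, n). T k n) \<in> soft_O UNIV (\<lambda>(k, n). f k n)"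
    unfolding soft_O_def mem_Collect_eq
    by (rule exI[of _ K'], rule exI[of _ "m + 2"]) (use f0 K'0 in \<open>auto simp: T_def abs_mult\<close>)
  \<comment> \<open>The deterministic half: once the weight is small, membership and the time bound
    hold for every word in the support.\<close>
  have good: "free_reduce (free_reduce v) \<in> MSP X R H \<and>
      running_time A R H (free_reduce (free_reduce v)) \<le> ereal (T k n)"
    if n: "3 \<le> n" and v: "v \<in> set_pmf (random_unreduced_word PI PH k n)"
      and nw: "nesting_weight X R H v < 2 ^ depth_bound n" for v k n
  proof -
    let ?w = "free_reduce (free_reduce v)" and ?D = "depth_bound n" and ?a = "(exp 1)\<^sup>2 * ln ?L"
    have ln_n: "1 \<le> ln (real n)"
      using exp_le n by (simp add: ln_ge_iff)
    have "4 * 1 \<le> (exp 1)\<^sup>2 * ln (real n)"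
      using exp_1_squared_bounds(1) ln_n by (intro mult_mono) auto
    then have D0: "0 < ?D" using depth_bound_bounds(2)[of n] n by linarith
    obtain ds where ds: "nested X R H ds v" "\<forall>d\<in>set ds. d < ?D"
      using random_unreduced_word_support[OF assms(8,9) M v] nested_depth_less nw by blast
    have w: "exits_at A R H ?w ?D" "?w \<in> MSP X R H"
      using nested_exits_at[OF assms(10,2,3,5,7) ds D0] by blast+
    have "length ?w \<le> (k + n) * M"
      using random_unreduced_word_support[OF assms(8,9) M v]
        length_free_reduce[of v] length_free_reduce[of "free_reduce v"] by linarith
    then have "input_size H ?w \<le> (k + n) * M + (total_length H + card H + 1) * 1"
      by (simp add: input_size_def)
    also have "\<dots> \<le> (k + n) * M + (total_length H + card H + 1) * (k + n)"
      using n by (intro add_left_mono mult_left_mono) auto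
    finally have "input_size H ?w \<le> (M + total_length H + card H + 1) * (k + n)"
      by (simp add: algebra_simps)
    then have inp: "real (input_size H ?w) \<le> c * real (k + n)"
      unfolding c_def by (metis of_nat_le_iff of_nat_mult)
    have na: "1 \<le> real n powr ?a" using n L by (intro ge_one_powr_ge_zero) auto
    \<comment> \<open>As L(R) \<ge> 1, the power of n is at least 1; hence n \<le> f and logarithms
      of n can be replaced by those of 2 + f.\<close>
    have "real n * 1 \<le> f k n"
      unfolding f_def using na n by (intro mult_mono) auto
    then have nf: "real n \<le> f k n" by simp
    then have f1: "1 \<le> f k n" using n by linarith
    have "ln (real n) \<le> ln (2 + f k n)" using nf n by simp
    moreover have "real ?D \<le> 9 * ln (real n)"
      using depth_bound_bounds(1)[of n] n mult_right_mono[OF exp_1_squared_bounds(2), of "ln (real n)"]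
        ln_n by linarith
    ultimately have D: "real ?D \<le> 9 * ln (2 + f k n)" and lf: "1 \<le> ln (2 + f k n)"
      using ln_n by linarith+
    have "real ((?D + 2) * input_size H ?w * total_length R ^ ?D)
        = (real ?D + 2) * real (input_size H ?w) * ?L ^ ?D"
      by (simp only: of_nat_mult of_nat_add of_nat_power of_nat_numeral)
    \<comment> \<open>The 11 comes from D + 2 \<le> 9 ln (2 + f) + 2 ln (2 + f).\<close>
    also have "\<dots> \<le> (11 * ln (2 + f k n)) * (c * real (k + n)) * real n powr ?a"
      using D lf inp power_depth_bound_le[of n ?L] n L c by (intro mult_mono) auto
    also have "\<dots> = 11 * c * f k n * ln (2 + f k n)" by (simp add: f_def mult_ac)
    finally have "running_time A R H ?w \<le> ereal (3 * (real ?D + 1) *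
        (K * (11 * c * f k n * ln (2 + f k n)) * ln (2 + 11 * c * f k n * ln (2 + f k n)) ^ m))"
      using w by (intro time) (auto simp: MSP_def)
    also have "\<dots> \<le> ereal (T k n)"
      unfolding T_def K'_def using soft_bound_absorb[OF f1 K c _ D] by simp
    finally show ?thesis using w(2) by blast
  qed
  have "(\<lambda>n. measure_pmf.prob (random_subgroup_word PI PH k n)
      {w \<in> MSP X R H. running_time A R H w \<le> ereal (T k n)}) \<longlonglongrightarrow> 1" for k
  proof (rule tendsto_sandwich)
    let ?Q = "\<lambda>n. random_unreduced_word PI PH k n"
    let ?p = "\<lambda>n. measure_pmf.prob (random_subgroup_word PI PH k n)
      {w \<in> MSP X R H. running_time A R H w \<le> ereal (T k n)}"
    \<comment> \<open>For n \<ge> k the length bound satisfies (k + n) M + 1 \<le> (2M + 1) n;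
      dividing its square by n^(8/3) / 2 leaves this constant times n^(-2/3).\<close>
    let ?b = "2 * (2 * real M + 1)\<^sup>2"
    have low: "1 - ?b * real n powr (- (2/3)) \<le> ?p n" if n: "max 3 k \<le> n" for n
    proof -
      let ?B = "{v. 2 ^ depth_bound n \<le> nesting_weight X R H v}"
      let ?G = "(\<lambda>v. free_reduce (free_reduce v)) -` {w \<in> MSP X R H. running_time A R H w \<le> ereal (T k n)}"
      \<comment> \<open>Only words in the support are known to have a nesting, so the complement of
        the bad event is first cut down to the support.\<close>
      have "- ?B \<inter> set_pmf (?Q n) \<subseteq> ?G"
        using good[of n _ k] n by auto
      then have "measure_pmf.prob (?Q n) (- ?B) \<le> measure_pmf.prob (?Q n) ?G"
        using measure_Int_set_pmf[of "?Q n" "- ?B"]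
          measure_pmf.finite_measure_mono[of "- ?B \<inter> set_pmf (?Q n)" ?G "?Q n"] by simp
      moreover have "?p n = measure_pmf.prob (?Q n) ?G"
        by (simp add: random_subgroup_word_eq_map)
      moreover have "measure_pmf.prob (?Q n) (- ?B) = 1 - measure_pmf.prob (?Q n) ?B"
        using measure_pmf.prob_compl[of ?B "?Q n"] by (simp add: Compl_eq_Diff_UNIV)
      moreover have "measure_pmf.prob (?Q n) ?B \<le> ?b * real n powr (- (2/3))"
      proof -
        have "measure_pmf.prob (?Q n) ?B \<le> (real ((k + n) * M) + 1)\<^sup>2 / 2 ^ depth_bound n"
          by (rule prob_nesting_weight_ge[OF assms(8,9) M])
        also have "\<dots> \<le> ((2 * real M + 1) * real n)\<^sup>2 / (real n powr (8/3) / 2)"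
        proof (intro frac_le power_mono)
          have "real (k + n) * real M \<le> (2 * real n) * real M"
            using n by (intro mult_right_mono) auto
          then show "real ((k + n) * M) + 1 \<le> (2 * real M + 1) * real n"
            using n by (simp add: algebra_simps)
          show "real n powr (8/3) / 2 \<le> 2 ^ depth_bound n"
            using two_power_depth_bound_ge[of n] n by simp
        qed (use n in auto)
        also have "\<dots> = ?b * ((real n)\<^sup>2 / real n powr (8/3))"
          by (simp add: power_mult_distrib)
        also have "(real n)\<^sup>2 / real n powr (8/3) = real n powr (- (2/3))"
          using n powr_diff[of "real n" 2 "8/3"] by (simp add: powr_numeral)
        finally show ?thesis .
      qed
      ultimately show ?thesis by linarith
    qed
    show "\<forall>\<^sub>F n in sequentially. 1 - ?b * real n powr (- (2/3)) \<le> ?p n"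
      using low by (intro eventually_sequentiallyI)
    show "\<forall>\<^sub>F n in sequentially. ?p n \<le> 1"
      by simp
    have "(\<lambda>n. real n powr (- (2/3))) \<longlonglongrightarrow> 0"
      by (intro tendsto_neg_powr filterlim_real_sequentially) simp
    from tendsto_diff[OF tendsto_const[of 1] tendsto_mult[OF tendsto_const[of ?b] this]]
    show "(\<lambda>n. 1 - ?b * real n powr (- (2/3))) \<longlonglongrightarrow> 1"
      by simp
    show "(\<lambda>n. 1) \<longlonglongrightarrow> (1::real)"
      by simp
  qed
  with soft show ?thesis
    unfolding f_def by (intro exI[of _ T]) blast
qed

end
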